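(* Let $(W,S)$ be a Coxeter system such that $S$ admits a well-ordering. Then every locally finite subgroup of $W$ is contained in a maximal locally finite subgroup of $W$, and every such maximal locally finite subgroup containing it is locally parabolic.
   Context: A group is locally finite if each finite subset generates a finite subgroup; a maximal locally finite subgroup is a locally finite subgroup not properly contained in another locally finite subgroup of $W$. For a reflection subgroup $G$ (subgroup generated by reflections), $S(G)=\{s_\gamma\mid\gamma\in\Pi(G)\}$ is its canonical generating set, where $\Pi(G)$ is the set of positive roots $\gamma$ (geometric representation) with $s_\gamma\in G$ not expressible as positive linear combinations of other positive roots $\beta$ with $s_\beta\in G$. $G\le W$ is locally parabolic if it is a reflection subgroup and each finite subset of $S(G)$ is conjugate in $W$ to a subset of $S$. *)

theory Defs
  imports Complex_Main "HOL-Algebra.Multiplicative_Group"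
begin

definition word_prod :: "('a, 'b) monoid_scheme \<Rightarrow> 'a list \<Rightarrow> 'a" where
  "word_prod G w = foldr (\<lambda>s x. s \<otimes>\<^bsub>G\<^esub> x) w \<one>\<^bsub>G\<^esub>"

text \<open>Congruence on words over S generated by the Coxeter relations
  (s t)^m(s,t) = 1, where m(s,t) is the order of s t (relations with
  m(s,t) = infinity, i.e. order 0, are absent; s = t gives s s = 1).\<close>
inductive cox_eq :: "('a, 'b) monoid_scheme \<Rightarrow> 'a set \<Rightarrow> 'a list \<Rightarrow> 'a list \<Rightarrow> bool"
  for G S where
  cox_refl: "cox_eq G S u u"
| cox_sym: "cox_eq G S u v \<Longrightarrow> cox_eq G S v u"
| cox_trans: "cox_eq G S u v \<Longrightarrow> cox_eq G S v w \<Longrightarrow> cox_eq G S u w"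
| cox_ctx: "cox_eq G S u v \<Longrightarrow> cox_eq G S (a @ u @ b) (a @ v @ b)"
| cox_rel: "s \<in> S \<Longrightarrow> t \<in> S \<Longrightarrow> group.ord G (s \<otimes>\<^bsub>G\<^esub> t) = m \<Longrightarrow> 0 < m
            \<Longrightarrow> cox_eq G S (concat (replicate m [s, t])) []"

definition coxeter_system :: "('a, 'b) monoid_scheme \<Rightarrow> 'a set \<Rightarrow> bool" where
  "coxeter_system W S \<longleftrightarrow> group W \<and> S \<subseteq> carrier W
     \<and> (\<forall>s\<in>S. s \<noteq> \<one>\<^bsub>W\<^esub> \<and> s \<otimes>\<^bsub>W\<^esub> s = \<one>\<^bsub>W\<^esub>)
     \<and> generate W S = carrier W
     \<and> (\<forall>w. set w \<subseteq> S \<longrightarrow> word_prod W w = \<one>\<^bsub>W\<^esub> \<longrightarrow> cox_eq W S w [])"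

text \<open>Vectors of V = real vector space with basis (alpha_s)_{s in S} are represented
  as finitely supported functions S -> real (coefficients).\<close>
definition cox_m :: "('a, 'b) monoid_scheme \<Rightarrow> 'a \<Rightarrow> 'a \<Rightarrow> nat" where
  "cox_m W s t = group.ord W (s \<otimes>\<^bsub>W\<^esub> t)"

definition cox_B0 :: "('a, 'b) monoid_scheme \<Rightarrow> 'a \<Rightarrow> 'a \<Rightarrow> real" where
  "cox_B0 W s t = (if cox_m W s t = 0 then -1 else - cos (pi / real (cox_m W s t)))"

definition supp :: "('a \<Rightarrow> real) \<Rightarrow> 'a set" where
  "supp v = {s. v s \<noteq> 0}"

definition cox_B :: "('a, 'b) monoid_scheme \<Rightarrow> ('a \<Rightarrow> real) \<Rightarrow> ('a \<Rightarrow> real) \<Rightarrow> real" where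
  "cox_B W u v = (\<Sum>s\<in>supp u. \<Sum>t\<in>supp v. u s * v t * cox_B0 W s t)"

definition simple_root :: "'a \<Rightarrow> 'a \<Rightarrow> real" where
  "simple_root s = (\<lambda>t. if t = s then 1 else 0)"

definition sigma :: "('a, 'b) monoid_scheme \<Rightarrow> 'a \<Rightarrow> ('a \<Rightarrow> real) \<Rightarrow> ('a \<Rightarrow> real)" where
  "sigma W s v = (\<lambda>t. v t - 2 * cox_B W (simple_root s) v * simple_root s t)"

text \<open>Action of w in W: pick any word over S representing w (well defined for
  Coxeter systems) and compose the simple reflections.\<close>
definition cox_act :: "('a, 'b) monoid_scheme \<Rightarrow> 'a set \<Rightarrow> 'a \<Rightarrow> ('a \<Rightarrow> real) \<Rightarrow> ('a \<Rightarrow> real)" where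
  "cox_act W S w v = foldr (sigma W) (SOME l. set l \<subseteq> S \<and> word_prod W l = w) v"

definition roots :: "('a, 'b) monoid_scheme \<Rightarrow> 'a set \<Rightarrow> ('a \<Rightarrow> real) set" where
  "roots W S = {cox_act W S w (simple_root s) | w s. w \<in> carrier W \<and> s \<in> S}"

definition pos_roots :: "('a, 'b) monoid_scheme \<Rightarrow> 'a set \<Rightarrow> ('a \<Rightarrow> real) set" where
  "pos_roots W S = {\<gamma> \<in> roots W S. \<forall>t. 0 \<le> \<gamma> t}"

definition refl_of :: "('a, 'b) monoid_scheme \<Rightarrow> 'a set \<Rightarrow> ('a \<Rightarrow> real) \<Rightarrow> 'a" where
  "refl_of W S \<gamma> = (SOME r. \<exists>w\<in>carrier W. \<exists>s\<in>S. \<gamma> = cox_act W S w (simple_root s)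
                        \<and> r = w \<otimes>\<^bsub>W\<^esub> s \<otimes>\<^bsub>W\<^esub> inv\<^bsub>W\<^esub> w)"

definition reflections :: "('a, 'b) monoid_scheme \<Rightarrow> 'a set \<Rightarrow> 'a set" where
  "reflections W S = {w \<otimes>\<^bsub>W\<^esub> s \<otimes>\<^bsub>W\<^esub> inv\<^bsub>W\<^esub> w | w s. w \<in> carrier W \<and> s \<in> S}"

definition reflection_subgroup :: "('a, 'b) monoid_scheme \<Rightarrow> 'a set \<Rightarrow> 'a set \<Rightarrow> bool" where
  "reflection_subgroup W S H \<longleftrightarrow> (\<exists>X. X \<subseteq> reflections W S \<and> H = generate W X)"

definition canon_roots :: "('a, 'b) monoid_scheme \<Rightarrow> 'a set \<Rightarrow> 'a set \<Rightarrow> ('a \<Rightarrow> real) set" where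
  "canon_roots W S H = {\<gamma> \<in> pos_roots W S. refl_of W S \<gamma> \<in> H \<and>
     \<not> (\<exists>F c. finite F \<and> F \<subseteq> {\<beta> \<in> pos_roots W S. refl_of W S \<beta> \<in> H \<and> \<beta> \<noteq> \<gamma>}
            \<and> (\<forall>\<beta>\<in>F. 0 < c \<beta>) \<and> \<gamma> = (\<lambda>t. \<Sum>\<beta>\<in>F. c \<beta> * \<beta> t))}"

definition canon_gens :: "('a, 'b) monoid_scheme \<Rightarrow> 'a set \<Rightarrow> 'a set \<Rightarrow> 'a set" where
  "canon_gens W S H = refl_of W S ` canon_roots W S H"

definition locally_parabolic :: "('a, 'b) monoid_scheme \<Rightarrow> 'a set \<Rightarrow> 'a set \<Rightarrow> bool" where
  "locally_parabolic W S H \<longleftrightarrow> reflection_subgroup W S H \<and>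
     (\<forall>F. finite F \<and> F \<subseteq> canon_gens W S H \<longrightarrow>
        (\<exists>w\<in>carrier W. (\<lambda>x. w \<otimes>\<^bsub>W\<^esub> x \<otimes>\<^bsub>W\<^esub> inv\<^bsub>W\<^esub> w) ` F \<subseteq> S))"

definition locally_finite_subgroup :: "('a, 'b) monoid_scheme \<Rightarrow> 'a set \<Rightarrow> bool" where
  "locally_finite_subgroup W H \<longleftrightarrow> subgroup H W \<and>
     (\<forall>F. finite F \<and> F \<subseteq> H \<longrightarrow> finite (generate W F))"

definition maximal_locally_finite_subgroup :: "('a, 'b) monoid_scheme \<Rightarrow> 'a set \<Rightarrow> bool" where
  "maximal_locally_finite_subgroup W H \<longleftrightarrow> locally_finite_subgroup W H \<and>
     (\<forall>K. locally_finite_subgroup W K \<and> H \<subseteq> K \<longrightarrow> K = H)"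

end

(* Every finite subgroup K lies in a smallest parabolic subgroup P(K), which is finite: averaging a
   generic positive functional on the span V of the simple roots over K gives a K-invariant functional
   that is nonpositive on only finitely many positive roots, hence has a dominant W-translate, whose
   stabilizer is a finite standard parabolic subgroup.  As P is monotone, the P(K) for the finite
   subgroups K of a maximal locally finite M form a directed family of finite subgroups.  Its union is
   locally finite and contains M, so it equals M.  If a canonical root gamma of M has its reflection
   in P(K) = w W_J w^-1, with w mapping the simple roots of J to positive roots, then gamma is a
   nonnegative combination of these images, hence equal to one of them.  Maximal locally finite
   subgroups exist by Zorn's lemma. *)
theory Submission
  imports Defs
begin

text \<open>Finiteness of the exceptional set puts no condition on \<open>S\<close>: every group
  element has only finitely many inversions, so a positive functional summed over \<open>K\<close>
  stays positive on each positive root that no element of \<open>K\<close> makes negative.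
  Genericity prevents an accident: a functional may vanish on a root whose average is nonzero, and
  its stabilizer could then exceed that of the averaging operator, which is the choice-free object
  that behaves monotonically. Maximality cannot be applied to a single P(K), because M and P(K)
  together are not known to generate a locally finite group; only the union of all the closures is a
  competitor of M. Functionals replace vectors because the bilinear form can be degenerate. The
  action and the reflections are given by Hilbert choice, so the presentation must first yield a
  well-defined action, and the sign dichotomy for roots its faithfulness.\<close>

locale coxeter = group W for W :: "('a, 'b) monoid_scheme" (structure) +
  fixes S :: "'a set"
  assumes coxeter_system: "coxeter_system W S"
begin

section \<open>Words in the simple reflections\<close>

lemma S_carrier: "s \<in> S \<Longrightarrow> s \<in> carrier W"
  and S_square: "s \<in> S \<Longrightarrow> s \<otimes> s = \<one>"
  and S_generates: "generate W S = carrier W"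
  and S_presentation: "set l \<subseteq> S \<Longrightarrow> word_prod W l = \<one> \<Longrightarrow> cox_eq W S l []"
  using coxeter_system by (auto simp: coxeter_system_def)

lemma S_inv: "s \<in> S \<Longrightarrow> inv s = s"
  by (simp add: S_carrier S_square inv_equality)

lemma mult_S_cancel [simp]: "w \<in> carrier W \<Longrightarrow> s \<in> S \<Longrightarrow> w \<otimes> s \<otimes> s = w"
  by (simp add: m_assoc S_carrier S_square)

lemma S_mult_cancel [simp]: "w \<in> carrier W \<Longrightarrow> s \<in> S \<Longrightarrow> s \<otimes> (s \<otimes> w) = w"
  by (simp add: m_assoc [symmetric] S_carrier S_square)

lemma word_prod_Nil [simp]: "word_prod W [] = \<one>"
  and word_prod_Cons [simp]: "word_prod W (s # l) = s \<otimes> word_prod W l"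
  by (simp_all add: word_prod_def)

lemma word_prod_closed [simp]: "set l \<subseteq> S \<Longrightarrow> word_prod W l \<in> carrier W"
  by (induction l) (auto simp: S_carrier)

lemma word_prod_append:
  "set l \<subseteq> S \<Longrightarrow> set l' \<subseteq> S \<Longrightarrow> word_prod W (l @ l') = word_prod W l \<otimes> word_prod W l'"
  by (induction l) (auto simp: S_carrier m_assoc)

lemma word_prod_rev: "set l \<subseteq> S \<Longrightarrow> word_prod W (rev l) = inv (word_prod W l)"
  by (induction l) (auto simp: word_prod_append S_carrier S_inv inv_mult_group)

lemma word_exists:
  assumes "w \<in> carrier W"
  obtains l where "set l \<subseteq> S" "word_prod W l = w"
proof -
  have "\<exists>l. set l \<subseteq> S \<and> word_prod W l = w" if "w \<in> generate W S" for w
    using that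
  proof induction
    case one
    then show ?case by (intro exI[of _ "[]"]) auto
  next
    case (incl h)
    then show ?case by (intro exI[of _ "[h]"]) (auto simp: S_carrier)
  next
    case (inv h)
    then show ?case by (intro exI[of _ "[h]"]) (auto simp: S_carrier S_inv)
  next
    case (eng h1 h2)
    then show ?case by (metis Un_least set_append word_prod_append)
  qed
  with assms that S_generates show ?thesis by blast
qed

subsection \<open>The geometric representation\<close>

text \<open>A \<open>sum\<close> over an infinite set is 0, so \<open>cox_B\<close> is bilinear only
  for finite supports, and its symmetry uses that the letters are involutions. Hence membership in
  \<open>V\<close> accompanies the rules below.\<close>

definition V :: "('a \<Rightarrow> real) set" where
  "V = {v. finite (supp v) \<and> supp v \<subseteq> S}"

abbreviation "act \<equiv> cox_act W S"

lemma V_comb: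
  assumes "u \<in> V" "v \<in> V"
  shows "(\<lambda>t. a * u t + b * v t) \<in> V"
proof -
  have "supp (\<lambda>t. a * u t + b * v t) \<subseteq> supp u \<union> supp v"
    by (auto simp: supp_def)
  moreover have "finite (supp u \<union> supp v)" "supp u \<union> supp v \<subseteq> S"
    using assms by (auto simp: V_def)
  ultimately show ?thesis
    unfolding V_def using finite_subset by blast
qed

lemma V_zero: "(\<lambda>t. 0) \<in> V"
  by (simp add: V_def supp_def)

lemma V_sum:
  assumes "finite I" "\<And>i. i \<in> I \<Longrightarrow> x i \<in> V"
  shows "(\<lambda>t. \<Sum>i\<in>I. c i * x i t) \<in> V"
  using assms
proof (induction I rule: finite_induct)
  case (insert i I)
  then have "(\<lambda>t. c i * x i t + 1 * (\<Sum>i\<in>I. c i * x i t)) \<in> V"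
    by (intro V_comb) auto
  then show ?case using insert by simp
qed (simp add: V_zero)

lemma supp_simple_root [simp]: "supp (simple_root s) = {s}"
  by (auto simp: supp_def simple_root_def)

lemma V_simple_root: "s \<in> S \<Longrightarrow> simple_root s \<in> V"
  by (simp add: V_def)

lemma V_expand: "v \<in> V \<Longrightarrow> v = (\<lambda>t. \<Sum>s\<in>supp v. v s * simple_root s t)"
proof -
  assume "v \<in> V"
  then have "finite (supp v)" by (simp add: V_def)
  then have "(\<Sum>s\<in>supp v. v s * simple_root s t) = (if t \<in> supp v then v t else 0)" for t
    by (simp add: simple_root_def if_distrib [of "(*) _"] cong: if_cong)
  then show ?thesis by (auto simp: supp_def)
qed

text \<open>Sums over the supports of different vectors cannot be added term by term; a common
  finite index set makes bilinearity and symmetry plain computations.\<close>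

lemma cox_B_superset:
  assumes "finite A" "supp u \<subseteq> A" "supp v \<subseteq> A"
  shows "cox_B W u v = (\<Sum>s\<in>A. \<Sum>t\<in>A. u s * v t * cox_B0 W s t)"
proof -
  have "(\<Sum>t\<in>supp v. u s * v t * cox_B0 W s t) = (\<Sum>t\<in>A. u s * v t * cox_B0 W s t)" for s
    using assms by (intro sum.mono_neutral_left) (auto simp: supp_def)
  then have "cox_B W u v = (\<Sum>s\<in>supp u. \<Sum>t\<in>A. u s * v t * cox_B0 W s t)"
    by (simp add: cox_B_def)
  also have "\<dots> = (\<Sum>s\<in>A. \<Sum>t\<in>A. u s * v t * cox_B0 W s t)"
    using assms by (intro sum.mono_neutral_left) (auto simp: supp_def)
  finally show ?thesis .
qed

lemma cox_B_comb_right: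
  assumes "u \<in> V" "v \<in> V" "z \<in> V"
  shows "cox_B W z (\<lambda>t. a * u t + b * v t) = a * cox_B W z u + b * cox_B W z v"
proof -
  define A where "A = supp u \<union> supp v \<union> supp z"
  have A: "finite A" "supp u \<subseteq> A" "supp v \<subseteq> A" "supp z \<subseteq> A"
    using assms by (auto simp: A_def V_def)
  moreover have "supp (\<lambda>t. a * u t + b * v t) \<subseteq> A"
    by (auto simp: A_def supp_def)
  ultimately show ?thesis
    by (simp add: cox_B_superset[of A] sum_distrib_left sum.distrib [symmetric] algebra_simps)
qed

lemma cox_B0_sym:
  assumes "s \<in> S" "t \<in> S"
  shows "cox_B0 W s t = cox_B0 W t s"
proof -
  have "inv (s \<otimes> t) = t \<otimes> s"
    using assms by (simp add: inv_mult_group S_carrier S_inv)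
  then have "ord (s \<otimes> t) = ord (t \<otimes> s)"
    using assms ord_inv[of "s \<otimes> t"] by (simp add: S_carrier)
  then show ?thesis by (simp add: cox_B0_def cox_m_def)
qed

lemma cox_B0_same: "s \<in> S \<Longrightarrow> cox_B0 W s s = 1"
  by (simp add: cox_B0_def cox_m_def S_square)

lemma cox_B_sym:
  assumes "u \<in> V" "v \<in> V"
  shows "cox_B W u v = cox_B W v u"
proof -
  define A where "A = supp u \<union> supp v"
  have A: "finite A" "supp u \<subseteq> A" "supp v \<subseteq> A" "A \<subseteq> S"
    using assms by (auto simp: A_def V_def)
  have "cox_B W u v = (\<Sum>s\<in>A. \<Sum>t\<in>A. u t * v s * cox_B0 W t s)"
    using A by (subst sum.swap) (simp add: cox_B_superset[of A])
  also have "\<dots> = (\<Sum>s\<in>A. \<Sum>t\<in>A. v s * u t * cox_B0 W s t)"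
    using A by (intro sum.cong refl) (metis (no_types, lifting) cox_B0_sym mult.commute subsetD)
  finally show ?thesis using A by (simp add: cox_B_superset[of A])
qed

lemma cox_B_simple [simp]: "cox_B W (simple_root s) (simple_root t) = cox_B0 W s t"
  by (simp add: cox_B_def) (simp add: simple_root_def)

text \<open>The factor 1 gives the reflection the shape \<open>a * u t + b * v t\<close> in which
  all linearity rules are stated; later reflection formulas keep it for the same reason.\<close>

lemma sigma_eq: "sigma W s v = (\<lambda>t. 1 * v t + (- 2 * cox_B W (simple_root s) v) * simple_root s t)"
  by (simp add: sigma_def)

lemma sigma_closed [simp]: "s \<in> S \<Longrightarrow> v \<in> V \<Longrightarrow> sigma W s v \<in> V"
  unfolding sigma_eq by (intro V_comb V_simple_root)

lemma sigma_comb: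
  assumes "s \<in> S" "u \<in> V" "v \<in> V"
  shows "sigma W s (\<lambda>t. a * u t + b * v t) = (\<lambda>t. a * sigma W s u t + b * sigma W s v t)"
  using assms by (simp add: sigma_def cox_B_comb_right V_simple_root algebra_simps)

lemma cox_B_sigma_right:
  assumes "s \<in> S" "v \<in> V" "z \<in> V"
  shows "cox_B W z (sigma W s v)
    = cox_B W z v - 2 * cox_B W (simple_root s) v * cox_B W z (simple_root s)"
  using cox_B_comb_right[of v "simple_root s" z 1 "- 2 * cox_B W (simple_root s) v"] assms
  by (simp add: sigma_def V_simple_root)

lemma sigma_isometry:
  assumes "s \<in> S" "u \<in> V" "v \<in> V"
  shows "cox_B W (sigma W s u) (sigma W s v) = cox_B W u v"
proof -
  note V = assms V_simple_root[OF \<open>s \<in> S\<close>] sigma_closed[OF \<open>s \<in> S\<close> \<open>u \<in> V\<close>]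
  have "cox_B W (sigma W s u) (sigma W s v)
      = cox_B W v (sigma W s u) - 2 * cox_B W (simple_root s) v * cox_B W (simple_root s) (sigma W s u)"
    by (subst cox_B_sigma_right, use V in blast, use V in blast, use V in blast)
      (simp only: cox_B_sym[OF V(5) V(3)] cox_B_sym[OF V(5) V(4)])
  also have "\<dots> = cox_B W v u"
    by (simp only: cox_B_sigma_right[OF V(1,2,3)] cox_B_sigma_right[OF V(1,2,4)]
        cox_B_sym[OF V(3,4)] cox_B_simple cox_B0_same[OF V(1)]) (simp add: algebra_simps)
  finally show ?thesis by (simp only: cox_B_sym[OF V(3) V(2)])
qed

lemma sigma_simple_root: "s \<in> S \<Longrightarrow> sigma W s (simple_root s) = (\<lambda>t. - simple_root s t)"
  by (simp add: sigma_def cox_B0_same)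

lemma sigma_sigma [simp]:
  assumes "s \<in> S" "v \<in> V"
  shows "sigma W s (sigma W s v) = v"
proof -
  have "sigma W s (sigma W s v) = (\<lambda>t. 1 * sigma W s v t + (- 2 * cox_B W (simple_root s) v) * sigma W s (simple_root s) t)"
    using assms by (subst (2) sigma_eq) (simp only: sigma_comb V_simple_root)
  also have "\<dots> = v"
    using assms by (simp add: sigma_simple_root) (simp add: sigma_def)
  finally show ?thesis .
qed


section \<open>Rank two: the plane of two simple roots\<close>

lemma cox_m_ge_2:
  assumes "s \<in> S" "t \<in> S" "s \<noteq> t" "cox_m W s t \<noteq> 0"
  shows "2 \<le> cox_m W s t"
proof -
  have "s \<otimes> t \<noteq> \<one>"
    using assms by (metis S_carrier S_mult_cancel S_square r_one)
  then have "cox_m W s t \<noteq> 1"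
    using assms ord_eq_1[of "s \<otimes> t"] by (auto simp: cox_m_def S_carrier)
  with assms show ?thesis by linarith
qed

lemma sigma_plane_left:
  assumes "s \<in> S" "t \<in> S"
  shows "sigma W s (\<lambda>r. a * simple_root s r + b * simple_root t r)
    = (\<lambda>r. (- 2 * cox_B0 W s t * b - a) * simple_root s r + b * simple_root t r)"
proof -
  have "cox_B W (simple_root s) (\<lambda>r. a * simple_root s r + b * simple_root t r) = a + b * cox_B0 W s t"
    using assms by (simp add: cox_B_comb_right V_simple_root cox_B0_same)
  then show ?thesis by (simp add: sigma_def algebra_simps)
qed

lemma sigma_plane_right:
  assumes "s \<in> S" "t \<in> S"
  shows "sigma W t (\<lambda>r. a * simple_root s r + b * simple_root t r)
    = (\<lambda>r. a * simple_root s r + (- 2 * cox_B0 W s t * a - b) * simple_root t r)"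
  using sigma_plane_left[OF assms(2,1), of b a] assms
  by (simp add: add.commute cox_B0_sym[of t s])

text \<open>If \<open>cox_B0 W s t = - cos \<theta>\<close>, the form on this plane is that of two
  unit vectors at angle \<open>pi - \<theta>\<close>. By the law of sines this is then
  \<open>sin \<theta>\<close> times the unit vector at angle \<phi> from
  \<open>simple_root s\<close>, so the product of the two reflections merely shifts \<phi>.\<close>

definition plane_vec :: "real \<Rightarrow> 'a \<Rightarrow> 'a \<Rightarrow> real \<Rightarrow> 'a \<Rightarrow> real" where
  "plane_vec \<theta> s t \<phi> = (\<lambda>r. sin (\<phi> + \<theta>) * simple_root s r + sin \<phi> * simple_root t r)"

text \<open>A simple reflection replaces one coordinate of a plane vector by -2
  \<open>cox_B0 W s t\<close> times the other minus itself; for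
  \<open>cox_B0 W s t = - cos \<theta>\<close> this recurrence is the one satisfied by sines in
  steps of \<theta>.\<close>

lemma sin_step: "2 * cos \<theta> * sin (\<phi> + \<theta>) - sin \<phi> = sin (\<phi> + 2 * \<theta>)" for \<theta> \<phi> :: real
proof -
  have "sin (\<phi> + 2 * \<theta>) + sin \<phi> = 2 * cos \<theta> * sin (\<phi> + \<theta>)"
    using sin_add[of "\<phi> + \<theta>" \<theta>] sin_diff[of "\<phi> + \<theta>" \<theta>] by (simp add: algebra_simps)
  then show ?thesis by simp
qed

lemma sigma_sigma_plane_vec:
  assumes "s \<in> S" "t \<in> S" "cox_B0 W s t = - cos \<theta>"
  shows "sigma W s (sigma W t (plane_vec \<theta> s t \<phi>)) = plane_vec \<theta> s t (\<phi> + 2 * \<theta>)"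
proof -
  have "2 * cos \<theta> * sin (\<phi> + 2 * \<theta>) - sin (\<phi> + \<theta>) = sin (\<phi> + 3 * \<theta>)"
    using sin_step[of \<theta> "\<phi> + \<theta>"] by (simp add: algebra_simps)
  moreover have "2 * cos \<theta> * sin (\<phi> + \<theta>) - sin \<phi> = sin (\<phi> + 2 * \<theta>)"
    by (rule sin_step)
  moreover have "\<phi> + 2 * \<theta> + \<theta> = \<phi> + 3 * \<theta>" by simp
  ultimately show ?thesis
    using assms unfolding plane_vec_def
    by (simp only: sigma_plane_right sigma_plane_left mult_minus_right minus_mult_left minus_minus)
qed

lemma foldr_sigma_closed [simp]: "set l \<subseteq> S \<Longrightarrow> v \<in> V \<Longrightarrow> foldr (sigma W) l v \<in> V"
  by (induction l) auto

lemma foldr_sigma_comb: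
  "set l \<subseteq> S \<Longrightarrow> u \<in> V \<Longrightarrow> v \<in> V \<Longrightarrow>
    foldr (sigma W) l (\<lambda>t. a * u t + b * v t) = (\<lambda>t. a * foldr (sigma W) l u t + b * foldr (sigma W) l v t)"
  by (induction l) (simp_all add: sigma_comb)

lemma foldr_sigma_rev: "set l \<subseteq> S \<Longrightarrow> v \<in> V \<Longrightarrow> foldr (sigma W) (rev l) (foldr (sigma W) l v) = v"
  by (induction l) auto

lemma foldr_plane_vec:
  assumes "s \<in> S" "t \<in> S" "cox_B0 W s t = - cos \<theta>"
  shows "foldr (sigma W) (concat (replicate n [s, t])) (plane_vec \<theta> s t \<phi>)
    = plane_vec \<theta> s t (\<phi> + 2 * n * \<theta>)"
  using assms by (induction n) (simp_all add: sigma_sigma_plane_vec algebra_simps)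

lemma foldr_orthogonal:
  assumes "cox_B W (simple_root s) v = 0" "cox_B W (simple_root t) v = 0"
  shows "foldr (sigma W) (concat (replicate n [s, t])) v = v"
  using assms by (induction n) (simp_all add: sigma_def)

text \<open>On the plane spanned by \<open>\<alpha>\<^sub>s, \<alpha>\<^sub>t\<close> the product is a rotation by
  \<open>2\<pi>/m\<close>; its orthogonal complement is fixed, and the two span since \<open>sin (\<pi>/m) \<noteq> 0\<close>.\<close>
lemma sigma_braid:
  assumes st: "s \<in> S" "t \<in> S" and m: "cox_m W s t = m" "0 < m" and v: "v \<in> V"
  shows "foldr (sigma W) (concat (replicate m [s, t])) v = v"
proof (cases "s = t")
  case True
  then have "m = 1" using st m by (simp add: cox_m_def S_square)
  then show ?thesis using True st v by simp
next
  case False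
  define \<theta> where "\<theta> = pi / m"
  have "2 \<le> m" using cox_m_ge_2[OF st False] m by simp
  then have "0 < \<theta>" "\<theta> < pi" by (auto simp: \<theta>_def field_simps)
  then have sin: "sin \<theta> > 0" by (simp add: sin_gt_zero)
  have B0: "cox_B0 W s t = - cos \<theta>" "cox_B0 W t s = - cos \<theta>"
    using st m cox_B0_sym[of s t] by (auto simp: cox_B0_def \<theta>_def)
  note [simp] = cox_B0_same[OF st(1)] cox_B0_same[OF st(2)] B0 V_simple_root[OF st(1)] V_simple_root[OF st(2)]
  let ?P = "plane_vec \<theta> s t"
  have P [simp]: "?P \<phi> \<in> V" for \<phi>
    unfolding plane_vec_def by (intro V_comb) simp_all
  define x where "x = cox_B W (simple_root s) v"
  define y where "y = cox_B W (simple_root t) v"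
  have BsP: "cox_B W (simple_root s) (?P \<phi>) = sin (\<phi> + \<theta>) - cos \<theta> * sin \<phi>"
    and BtP: "cox_B W (simple_root t) (?P \<phi>) = sin \<phi> - cos \<theta> * sin (\<phi> + \<theta>)" for \<phi>
    unfolding plane_vec_def by (simp_all add: cox_B_comb_right)
  have s0: "cox_B W (simple_root s) (?P 0) = sin \<theta>" "cox_B W (simple_root t) (?P 0) = - cos \<theta> * sin \<theta>"
    by (simp_all add: BsP BtP)
  have s1: "cox_B W (simple_root s) (?P (- \<theta>)) = cos \<theta> * sin \<theta>" "cox_B W (simple_root t) (?P (- \<theta>)) = - sin \<theta>"
    by (simp_all add: BsP BtP)
  define D where "D = (sin \<theta>)^2 * sin \<theta>"
  have D: "D \<noteq> 0" "D = (1 - (cos \<theta>)^2) * sin \<theta>"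
    using sin by (simp_all add: D_def sin_squared_eq [symmetric])
  \<comment> \<open>The projection \<open>p\<close> of \<open>v\<close> to the plane must have the
    products \<open>x\<close> and \<open>y\<close> with the two simple roots. Cramer's rule for its
    coordinates with respect to \<open>?P 0\<close> and \<open>?P (- \<theta>)\<close> has
    determinant of absolute value sin^4 \<theta>; one factor \<open>sin \<theta>\<close> cancels,
    which leaves the cube \<open>D\<close>.\<close>
  define a where "a = (x + cos \<theta> * y) / D"
  define b where "b = - (y + cos \<theta> * x) / D"
  define p where "p = (\<lambda>r. a * ?P 0 r + b * ?P (- \<theta>) r)"
  define z where "z = (\<lambda>r. 1 * v r + (- 1) * p r)"
  have pV: "p \<in> V" unfolding p_def by (intro V_comb) simp_all
  have zV: "z \<in> V" unfolding z_def using v pV by (intro V_comb)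
  have "cox_B W (simple_root s) p = x"
  proof -
    have "cox_B W (simple_root s) p = a * sin \<theta> + b * (cos \<theta> * sin \<theta>)"
      unfolding p_def by (simp add: cox_B_comb_right s0 s1)
    also have "\<dots> = x * ((1 - (cos \<theta>)^2) * sin \<theta>) / D"
      using D(1) by (simp add: a_def b_def field_simps power2_eq_square)
    finally show ?thesis using D by simp
  qed
  moreover have "cox_B W (simple_root t) p = y"
  proof -
    have "cox_B W (simple_root t) p = - a * cos \<theta> * sin \<theta> - b * sin \<theta>"
      unfolding p_def by (simp add: cox_B_comb_right s0 s1)
    also have "\<dots> = y * ((1 - (cos \<theta>)^2) * sin \<theta>) / D"
      using D(1) by (simp add: a_def b_def field_simps power2_eq_square)
    finally show ?thesis using D by simp
  qed
  ultimately have z0: "cox_B W (simple_root s) z = 0" "cox_B W (simple_root t) z = 0"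
    using cox_B_comb_right[OF v pV, of "simple_root s" 1 "-1"] cox_B_comb_right[OF v pV, of "simple_root t" 1 "-1"]
    by (simp_all add: z_def x_def y_def)
  let ?F = "foldr (sigma W) (concat (replicate m [s, t]))"
  have setl: "set (concat (replicate m [s, t])) \<subseteq> S" using st by auto
  have turn: "2 * real m * \<theta> = 2 * pi" using \<open>2 \<le> m\<close> by (simp add: \<theta>_def)
  have "?F (?P \<phi>) = ?P (\<phi> + 2 * pi)" for \<phi>
    by (simp only: foldr_plane_vec[OF st B0(1)] turn)
  moreover have "?P (\<phi> + 2 * pi) = ?P \<phi>" for \<phi>
    using sin_periodic[of "\<phi> + \<theta>"] sin_periodic[of \<phi>] by (simp add: plane_vec_def ac_simps)
  ultimately have FP: "?F (?P \<phi>) = ?P \<phi>" for \<phi> by simp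
  have Fp: "?F p = p"
    unfolding p_def using foldr_sigma_comb[OF setl P P, of a 0 b "- \<theta>"] by (simp only: FP)
  have "v = (\<lambda>r. 1 * p r + 1 * z r)" by (simp add: z_def)
  moreover have "?F (\<lambda>r. 1 * p r + 1 * z r) = (\<lambda>r. 1 * p r + 1 * z r)"
    by (simp only: foldr_sigma_comb[OF setl pV zV] Fp foldr_orthogonal[OF z0])
  ultimately show ?thesis by simp
qed

section \<open>The action of W on V\<close>

lemma cox_eq_letters: "cox_eq W S l l' \<Longrightarrow> set l \<subseteq> S \<longleftrightarrow> set l' \<subseteq> S"
  by (induction rule: cox_eq.induct) auto

lemma cox_eq_foldr_sigma:
  "cox_eq W S l l' \<Longrightarrow> set l \<subseteq> S \<Longrightarrow> v \<in> V \<Longrightarrow> foldr (sigma W) l v = foldr (sigma W) l' v"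
proof (induction arbitrary: v rule: cox_eq.induct)
  case (cox_rel s t m)
  then show ?case using sigma_braid[of s t m v] by (simp add: cox_m_def)
qed (auto simp: cox_eq_letters)

text \<open>\<open>cox_act\<close> uses a word picked by choice. For two words \<open>l\<close> and
  \<open>k\<close> with the same product, \<open>rev l @ k\<close> represents \<one>, so by the
  presentation it is congruent to the empty word and acts trivially; undoing \<open>rev l\<close>
  gives equality of the two actions.\<close>

lemma act_word:
  assumes l: "set l \<subseteq> S" and v: "v \<in> V"
  shows "act (word_prod W l) v = foldr (sigma W) l v"
proof -
  define k where "k = (SOME k. set k \<subseteq> S \<and> word_prod W k = word_prod W l)"
  have k: "set k \<subseteq> S" "word_prod W k = word_prod W l"
    using someI[of "\<lambda>k. set k \<subseteq> S \<and> word_prod W k = word_prod W l" l] l by (auto simp: k_def)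
  have "word_prod W (rev l @ k) = \<one>"
    using l k by (simp add: word_prod_append word_prod_rev)
  then have "foldr (sigma W) (rev l @ k) v = foldr (sigma W) [] v"
    using l k v by (intro cox_eq_foldr_sigma S_presentation) auto
  then have "foldr (sigma W) (rev (rev l)) (foldr (sigma W) (rev l) (foldr (sigma W) k v)) = foldr (sigma W) l v"
    by simp
  then have "foldr (sigma W) k v = foldr (sigma W) l v"
    using l k v by (subst (asm) foldr_sigma_rev) auto
  then show ?thesis by (simp add: cox_act_def k_def)
qed

lemma act_closed [simp]: "w \<in> carrier W \<Longrightarrow> v \<in> V \<Longrightarrow> act w v \<in> V"
  by (metis act_word foldr_sigma_closed word_exists)

lemma act_comb:
  assumes "w \<in> carrier W" "u \<in> V" "v \<in> V"
  shows "act w (\<lambda>t. a * u t + b * v t) = (\<lambda>t. a * act w u t + b * act w v t)"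
proof -
  obtain l where "set l \<subseteq> S" "word_prod W l = w" using assms word_exists by blast
  then show ?thesis using assms by (auto simp: act_word foldr_sigma_comb V_comb)
qed

lemma act_one [simp]: "v \<in> V \<Longrightarrow> act \<one> v = v"
  using act_word[of "[]"] by simp

lemma act_S [simp]: "s \<in> S \<Longrightarrow> v \<in> V \<Longrightarrow> act s v = sigma W s v"
  using act_word[of "[s]" v] by (simp add: S_carrier)

lemma act_mult:
  assumes "u \<in> carrier W" "w \<in> carrier W" "v \<in> V"
  shows "act (u \<otimes> w) v = act u (act w v)"
proof -
  obtain k l where "set k \<subseteq> S" "word_prod W k = u" "set l \<subseteq> S" "word_prod W l = w"
    using assms word_exists by metis
  then show ?thesis using assms act_word[of "k @ l" v] by (simp add: word_prod_append act_word[symmetric])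
qed

lemma act_inv_act [simp]: "w \<in> carrier W \<Longrightarrow> v \<in> V \<Longrightarrow> act (inv w) (act w v) = v"
  and act_act_inv [simp]: "w \<in> carrier W \<Longrightarrow> v \<in> V \<Longrightarrow> act w (act (inv w) v) = v"
  by (simp_all flip: act_mult)

lemma act_scale:
  assumes "w \<in> carrier W" "v \<in> V"
  shows "act w (\<lambda>t. a * v t) = (\<lambda>t. a * act w v t)"
  using act_comb[of w v v a 0] assms by simp

lemma act_uminus:
  assumes "w \<in> carrier W" "v \<in> V"
  shows "act w (\<lambda>t. - v t) = (\<lambda>t. - act w v t)"
  using act_scale[of w v "-1"] assms by simp

lemma act_sum:
  assumes w: "w \<in> carrier W" and I: "finite I" "\<And>i. i \<in> I \<Longrightarrow> x i \<in> V"
  shows "act w (\<lambda>t. \<Sum>i\<in>I. c i * x i t) = (\<lambda>t. \<Sum>i\<in>I. c i * act w (x i) t)"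
  using I
proof (induction I rule: finite_induct)
  case empty
  then show ?case using act_scale[OF w V_zero, of 0] by simp
next
  case (insert i I)
  then have "act w (\<lambda>t. c i * x i t + 1 * (\<Sum>i\<in>I. c i * x i t))
      = (\<lambda>t. c i * act w (x i) t + 1 * act w (\<lambda>t. \<Sum>i\<in>I. c i * x i t) t)"
    by (intro act_comb w V_sum) auto
  then show ?case using insert by simp
qed

lemma act_isometry:
  assumes "w \<in> carrier W" "u \<in> V" "v \<in> V"
  shows "cox_B W (act w u) (act w v) = cox_B W u v"
proof -
  have "cox_B W (foldr (sigma W) l u) (foldr (sigma W) l v) = cox_B W u v" if "set l \<subseteq> S" for l
    using that assms by (induction l) (auto simp: sigma_isometry)
  then show ?thesis using assms by (metis act_word word_exists)
qed

subsection \<open>Length\<close>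

definition len :: "'a \<Rightarrow> nat" where
  "len w = (LEAST n. \<exists>l. set l \<subseteq> S \<and> word_prod W l = w \<and> length l = n)"

lemma reduced_word:
  assumes "w \<in> carrier W"
  obtains l where "set l \<subseteq> S" "word_prod W l = w" "length l = len w"
proof -
  have "\<exists>n l. set l \<subseteq> S \<and> word_prod W l = w \<and> length l = n"
    using assms word_exists by metis
  from LeastI_ex[OF this] that show ?thesis by (auto simp: len_def)
qed

lemma len_le: "set l \<subseteq> S \<Longrightarrow> len (word_prod W l) \<le> length l"
  unfolding len_def by (rule Least_le) auto

lemma len_mult_le:
  assumes "u \<in> carrier W" "w \<in> carrier W"
  shows "len (u \<otimes> w) \<le> len u + len w"
proof -
  obtain k l where "set k \<subseteq> S" "word_prod W k = u" "length k = len u"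
    "set l \<subseteq> S" "word_prod W l = w" "length l = len w"
    using assms reduced_word by metis
  then show ?thesis using len_le[of "k @ l"] by (simp add: word_prod_append)
qed

lemma len_S_le: "s \<in> S \<Longrightarrow> len s \<le> 1"
  using len_le[of "[s]"] by (simp add: S_carrier)

lemma len_mult_S_le: "w \<in> carrier W \<Longrightarrow> s \<in> S \<Longrightarrow> len (w \<otimes> s) \<le> Suc (len w)"
  using len_mult_le[of w s] len_S_le[of s] by (simp add: S_carrier)

lemma descent_exists:
  assumes "w \<in> carrier W" "w \<noteq> \<one>"
  obtains t where "t \<in> S" "len (w \<otimes> t) < len w"
proof -
  obtain l where l: "set l \<subseteq> S" "word_prod W l = w" "length l = len w"
    using assms reduced_word by metis
  with assms(2) obtain k t where kt: "l = k @ [t]" by (cases l rule: rev_cases) auto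
  with l have "w \<otimes> t = word_prod W k" by (auto simp: word_prod_append S_carrier)
  with l kt that[of t] len_le[of k] show ?thesis by auto
qed


subsection \<open>Roots are positive or negative\<close>

text \<open>The alternating product of \<open>k\<close> letters whose last letter is
  \<open>t\<close>. Letters are split off on the right because the last one acts first on a root;
  the first letter then depends on the parity of \<open>k\<close>.\<close>

fun alt :: "'a \<Rightarrow> 'a \<Rightarrow> nat \<Rightarrow> 'a" where
  "alt s t 0 = \<one>"
| "alt s t (Suc k) = alt t s k \<otimes> t"

lemma alt_closed [simp]: "s \<in> S \<Longrightarrow> t \<in> S \<Longrightarrow> alt s t k \<in> carrier W"
  by (induction k arbitrary: s t) (auto simp: S_carrier)

lemma alt_Suc_left:
  "s \<in> S \<Longrightarrow> t \<in> S \<Longrightarrow> alt s t (Suc k) = (if even k then t else s) \<otimes> alt s t k"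
proof (induction k arbitrary: s t)
  case (Suc k)
  have "alt s t (Suc (Suc k)) = alt t s (Suc k) \<otimes> t" by simp
  also have "\<dots> = (if even k then s else t) \<otimes> (alt t s k \<otimes> t)"
    using Suc by (simp add: m_assoc S_carrier del: alt.simps)
  finally show ?case by simp
qed (simp add: S_carrier)

lemma alt_even: "s \<in> S \<Longrightarrow> t \<in> S \<Longrightarrow> alt s t (2 * j) = (s \<otimes> t) [^] j"
proof (induction j)
  case (Suc j)
  then show ?case by (simp add: m_assoc S_carrier nat_pow_Suc)
qed simp

lemma alt_odd: "s \<in> S \<Longrightarrow> t \<in> S \<Longrightarrow> alt s t (Suc (2 * j)) = t \<otimes> (s \<otimes> t) [^] j"
  using alt_Suc_left[of s t "2 * j"] by (simp add: alt_even del: alt.simps)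

lemma pow_swap: "s \<in> S \<Longrightarrow> t \<in> S \<Longrightarrow> (t \<otimes> s) [^] (j::nat) = inv ((s \<otimes> t) [^] j)"
  by (simp add: nat_pow_inv [symmetric] inv_mult_group S_carrier S_inv)

text \<open>This is \<open>g [^] ord g = \<one>\<close> read halfway, with
  \<open>g = s \<otimes> t\<close>. For order 2j, \<open>g [^] j\<close> is its own inverse; for
  order 2j + 1, its inverse is \<open>g [^] Suc j\<close>. Swapping the letters inverts powers of
  \<open>g\<close>. For infinite order \<open>ord\<close> is 0 and both sides are \<one>.\<close>

lemma alt_braid:
  assumes "s \<in> S" "t \<in> S"
  shows "alt s t (ord (s \<otimes> t)) = alt t s (ord (s \<otimes> t))"
proof -
  define g where "g = s \<otimes> t"
  have g: "g \<in> carrier W" "g [^] ord g = \<one>"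
    using assms by (auto simp: g_def S_carrier)
  show ?thesis
  proof (cases "even (ord g)")
    case True
    then obtain j where j: "ord g = 2 * j" by blast
    then have "g [^] j \<otimes> g [^] j = \<one>"
      using g by (simp add: nat_pow_mult mult_2)
    then have "inv (g [^] j) = g [^] j" using g by (simp add: inv_equality)
    then show ?thesis
      using assms j pow_swap[OF assms, of j] by (simp add: g_def [symmetric] alt_even)
  next
    case False
    then obtain j where j: "ord g = Suc (2 * j)" by (auto elim: oddE)
    then have "Suc j + j = ord g" by simp
    then have "g [^] Suc j \<otimes> g [^] j = \<one>"
      using nat_pow_mult[OF g(1), of "Suc j" j] g(2) by (simp only:)
    then have "inv (g [^] j) = g [^] Suc j"
      using g by (intro inv_equality) simp_all
    then have "inv (g [^] j) = g \<otimes> g [^] j"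
      using g by (simp only: nat_pow_Suc2)
    then have "alt t s (ord g) = s \<otimes> (g \<otimes> g [^] j)"
      using j alt_odd[OF assms(2,1), of j] pow_swap[OF assms, of j] by (simp add: g_def [symmetric] del: alt.simps)
    also have "\<dots> = t \<otimes> g [^] j"
      using assms g by (simp add: g_def m_assoc S_carrier)
    also have "\<dots> = alt s t (ord g)"
      using assms j alt_odd[of s t j] by (simp add: g_def del: alt.simps)
    finally show ?thesis by (simp add: g_def)
  qed
qed

text \<open>The prefix \<open>g\<close> is itself alternating, but its letters depend on parities;
  only the bound on its length is used, so it is left existential.\<close>

lemma alt_split:
  assumes "s \<in> S" "t \<in> S"
  shows "\<exists>g\<in>carrier W. len g \<le> j \<and> alt s t (j + m) = g \<otimes> alt s t m"
proof (induction j)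
  case 0
  then show ?case using assms len_le[of "[]"] by (intro bexI[of _ \<one>]) auto
next
  case (Suc j)
  then obtain g where g: "g \<in> carrier W" "len g \<le> j" "alt s t (j + m) = g \<otimes> alt s t m"
    by blast
  define x where "x = (if even (j + m) then t else s)"
  have x: "x \<in> S" using assms by (simp add: x_def)
  have "alt s t (Suc j + m) = x \<otimes> (g \<otimes> alt s t m)"
    using alt_Suc_left[OF assms, of "j + m"] g by (simp add: x_def del: alt.simps)
  moreover have "len (x \<otimes> g) \<le> Suc j"
    using len_mult_le[of x g] len_S_le[of x] x g by (simp add: S_carrier)
  ultimately show ?case
    using x g assms by (intro bexI[of _ "x \<otimes> g"]) (simp_all add: S_carrier m_assoc del: alt.simps)
qed

lemma len_alt_le: "s \<in> S \<Longrightarrow> t \<in> S \<Longrightarrow> len (alt s t k) \<le> k"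
proof (induction k arbitrary: s t)
  case 0
  then show ?case using len_le[of "[]"] by simp
next
  case (Suc k)
  have "len (alt t s k) \<le> k" by (rule Suc.IH[OF Suc.prems(2,1)])
  moreover have "len (alt t s k \<otimes> t) \<le> Suc (len (alt t s k))"
    using Suc.prems by (intro len_mult_S_le) simp_all
  ultimately show ?case by simp
qed

text \<open>Each reflection advances a pair of consecutive terms of \<open>q\<close> by one index.
  Keeping \<open>q\<close> an arbitrary solution of the recurrence treats finite and infinite order
  of \<open>s \<otimes> t\<close> together.\<close>

lemma act_alt:
  assumes "s \<in> S" "t \<in> S" "\<And>i. q (Suc (Suc i)) = - 2 * cox_B0 W s t * q (Suc i) - q i"
  shows "act (alt s t k) (\<lambda>r. q (Suc j) * simple_root s r + q j * simple_root t r)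
    = (if even k then (\<lambda>r. q (Suc (j + k)) * simple_root s r + q (j + k) * simple_root t r)
       else (\<lambda>r. q (j + k) * simple_root s r + q (Suc (j + k)) * simple_root t r))"
  using assms
proof (induction k arbitrary: s t j)
  case 0
  then show ?case by (simp add: V_comb V_simple_root)
next
  case (Suc k)
  let ?v = "\<lambda>r. q (Suc j) * simple_root s r + q j * simple_root t r"
  have V: "?v \<in> V" using Suc.prems by (intro V_comb V_simple_root)
  have "act (alt s t (Suc k)) ?v = act (alt t s k) (sigma W t ?v)"
    using Suc.prems V by (simp add: act_mult S_carrier)
  also have "sigma W t ?v = (\<lambda>r. q (Suc (Suc j)) * simple_root t r + q (Suc j) * simple_root s r)"
    using Suc.prems(3)[of j]
    by (simp only: sigma_plane_right[OF Suc.prems(1,2)]) (simp add: add.commute)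
  also have "act (alt t s k) \<dots> =
      (if even k then (\<lambda>r. q (Suc (Suc j + k)) * simple_root t r + q (Suc j + k) * simple_root s r)
       else (\<lambda>r. q (Suc j + k) * simple_root t r + q (Suc (Suc j + k)) * simple_root s r))"
    using Suc.prems by (intro Suc.IH) (simp_all add: cox_B0_sym[of t s])
  finally show ?case by (auto simp: add.commute)
qed

lemma act_alt_nonneg:
  assumes st: "s \<in> S" "t \<in> S" "s \<noteq> t" and k: "cox_m W s t = 0 \<or> k < cox_m W s t"
  obtains a b where "0 \<le> a" "0 \<le> b"
    "act (alt s t k) (simple_root s) = (\<lambda>r. a * simple_root s r + b * simple_root t r)"
proof -
  define m where "m = cox_m W s t"
  \<comment> \<open>The solution of the recurrence with \<open>q 0 = 0\<close>: sines in steps of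
    pi/m, degenerating to \<open>j\<close> when the form has value -1. As \<open>k < m\<close>
    implies \<open>Suc k \<le> m\<close>, all sines needed lie on [0, pi]. Dividing by
    \<open>q 1\<close> normalizes the start to \<open>simple_root s\<close>.\<close>
  define q where "q j = (if m = 0 then real j else sin (j * (pi / m)))" for j :: nat
  have m2: "m = 0 \<or> 2 \<le> m" using cox_m_ge_2[OF st] by (auto simp: m_def)
  have rec: "q (Suc (Suc i)) = - 2 * cox_B0 W s t * q (Suc i) - q i" for i
  proof (cases "m = 0")
    case False
    have "q (Suc (Suc i)) = sin (i * (pi / m) + 2 * (pi / m))"
      using False by (simp add: q_def algebra_simps add_divide_distrib)
    also have "\<dots> = 2 * cos (pi / m) * sin (i * (pi / m) + pi / m) - sin (i * (pi / m))"
      by (simp only: sin_step)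
    also have "sin (i * (pi / m) + pi / m) = q (Suc i)"
      using False by (simp add: q_def algebra_simps add_divide_distrib)
    also have "2 * cos (pi / m) = - 2 * cox_B0 W s t"
      using False by (simp add: cox_B0_def m_def)
    also have "sin (i * (pi / m)) = q i" using False by (simp add: q_def)
    finally show ?thesis .
  qed (simp add: q_def cox_B0_def m_def)
  have q1: "q 1 > 0"
    using m2 by (auto simp: q_def intro!: sin_gt_zero) (auto simp: field_simps)
  have qpos: "0 \<le> q i" if "m = 0 \<or> i \<le> m" for i
    using that by (auto simp: q_def intro!: sin_ge_zero) (auto simp: field_simps)
  define a where "a = (if even k then q (Suc k) else q k) / q 1"
  define b where "b = (if even k then q k else q (Suc k)) / q 1"
  have "act (alt s t k) (\<lambda>r. q (Suc 0) * simple_root s r + q 0 * simple_root t r)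
      = (\<lambda>r. q 1 * (a * simple_root s r + b * simple_root t r))"
    using act_alt[where q = q, OF st(1,2) rec, of k 0] q1 by (auto simp: a_def b_def algebra_simps)
  moreover have "(\<lambda>r. q (Suc 0) * simple_root s r + q 0 * simple_root t r) = (\<lambda>r. q 1 * simple_root s r)"
    by (simp add: q_def)
  ultimately have "(\<lambda>r. q 1 * act (alt s t k) (simple_root s) r) = (\<lambda>r. q 1 * (a * simple_root s r + b * simple_root t r))"
    using st by (simp add: act_scale V_simple_root)
  then have "act (alt s t k) (simple_root s) = (\<lambda>r. a * simple_root s r + b * simple_root t r)"
    using q1 by (auto simp: fun_eq_iff)
  moreover have "0 \<le> a" "0 \<le> b"
    using q1 qpos[of k] qpos[of "Suc k"] k by (auto simp: a_def b_def m_def)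
  ultimately show ?thesis using that by blast
qed

text \<open>Split off from \<open>w\<close> the longest alternating suffix in \<open>s, t\<close>: it is shorter than
  \<open>m(s,t)\<close>, so it sends \<open>\<alpha>\<^sub>s\<close> to a nonnegative combination of \<open>\<alpha>\<^sub>s, \<alpha>\<^sub>t\<close>,
  and the remaining prefix is lengthened by both \<open>s\<close> and \<open>t\<close>.\<close>
theorem act_simple_root_nonneg:
  assumes "w \<in> carrier W" "s \<in> S" "len w \<le> len (w \<otimes> s)"
  shows "0 \<le> act w (simple_root s) r"
  using assms
proof (induction "len w" arbitrary: w s r rule: less_induct)
  case less
  show ?case
  proof (cases "w = \<one>")
    case True
    then show ?thesis using less.prems by (simp add: V_simple_root) (simp add: simple_root_def)
  next
    case False
    with less.prems obtain t where t: "t \<in> S" "len (w \<otimes> t) < len w" using descent_exists by blast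
    with less.prems have st: "s \<noteq> t" by auto
    note S = less.prems(2) t(1)
    \<comment> \<open>The possible lengths of alternating suffixes that split off without making the
      total length exceed \<open>len w\<close>. The descent \<open>t\<close> gives
      \<open>1 \<in> A\<close>, so the prefix for the maximal \<open>k\<close> is shorter than
      \<open>w\<close> and the induction hypothesis applies to it.\<close>
    define A where "A = {k. \<exists>v\<in>carrier W. w = v \<otimes> alt s t k \<and> len v + k \<le> len w}"
    have "1 \<in> A"
      unfolding A_def using less.prems t
      by (intro CollectI bexI[of _ "w \<otimes> t"]) (auto simp: S_carrier)
    moreover have "finite A" by (rule finite_subset[of _ "{..len w}"]) (auto simp: A_def)
    ultimately have MaxA: "Max A \<in> A" "\<And>k. k \<in> A \<Longrightarrow> k \<le> Max A" "1 \<le> Max A"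
      by (auto intro: Max_in)
    define k where "k = Max A"
    obtain k' where k': "k = Suc k'" using MaxA(3) by (cases k) (auto simp: k_def)
    obtain v where v: "v \<in> carrier W" "w = v \<otimes> alt s t k" "len v + k \<le> len w"
      using MaxA(1) by (auto simp: A_def k_def)
    \<comment> \<open>Of the two letters, one would extend the alternating suffix, contradicting
      maximality of \<open>k\<close>; the other is its first letter and cancels, which would make
      \<open>w\<close> shorter than \<open>len w\<close>.\<close>
    have up: "len v \<le> len (v \<otimes> x)" if x: "x = s \<or> x = t" for x
    proof (rule ccontr)
      assume "\<not> ?thesis"
      then have short: "len (v \<otimes> x) < len v" by simp
      have xS: "x \<in> S" using x S by auto
      show False
      proof (cases "x = (if even k then t else s)")
        case True
        have "w = (v \<otimes> x) \<otimes> alt s t (Suc k)"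
          using v xS S alt_Suc_left[OF S, of k] True by (simp add: m_assoc S_carrier del: alt.simps)
        then have "Suc k \<in> A"
          unfolding A_def using short v xS by (intro CollectI bexI[of _ "v \<otimes> x"]) (auto simp: S_carrier)
        then show False using MaxA(2)[of "Suc k"] by (simp add: k_def)
      next
        case False
        with x have "x = (if even k' then t else s)" by (auto simp: k')
        then have "alt s t k = x \<otimes> alt s t k'"
          using alt_Suc_left[OF S, of k'] by (simp add: k' del: alt.simps)
        then have "w = (v \<otimes> x) \<otimes> alt s t k'"
          using v xS S by (simp add: m_assoc S_carrier)
        then have "len w \<le> len (v \<otimes> x) + k'"
          using len_mult_le[of "v \<otimes> x" "alt s t k'"] len_alt_le[OF S, of k'] v xS S by (simp add: S_carrier)
        then show False using short v(3) k' by simp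
      qed
    qed
    \<comment> \<open>Otherwise the last m letters of the suffix could be rewritten by the braid
      relation so as to end in \<open>s\<close>, and \<open>w \<otimes> s\<close> would be shorter
      than \<open>w\<close>.\<close>
    have "k < cox_m W s t" if m: "cox_m W s t \<noteq> 0"
    proof (rule ccontr)
      assume k: "\<not> ?thesis"
      define m where "m = cox_m W s t"
      obtain m' where m': "m = Suc m'" using m by (cases m) (auto simp: m_def)
      obtain g where g: "g \<in> carrier W" "len g \<le> k - m" "alt s t (k - m + m) = g \<otimes> alt s t m"
        using alt_split[OF S, of "k - m" m] by blast
      have "alt s t m = alt t s m" using alt_braid[OF S] by (simp add: m_def cox_m_def)
      then have "alt s t k = g \<otimes> (alt s t m' \<otimes> s)"
        using g(3) k by (simp add: m_def [symmetric]) (simp add: m')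
      then have "w \<otimes> s = (v \<otimes> g) \<otimes> alt s t m'"
        using v(1,2) g(1) S by (simp add: m_assoc S_carrier S_square)
      then have "len (w \<otimes> s) \<le> len v + len g + m'"
        using len_mult_le[of "v \<otimes> g" "alt s t m'"] len_mult_le[of v g] len_alt_le[OF S, of m'] v g S
        by simp
      then show False using g(2) k v(3) less.prems(3) m' by (simp add: m_def)
    qed
    then obtain a b where ab: "0 \<le> a" "0 \<le> b"
      "act (alt s t k) (simple_root s) = (\<lambda>r. a * simple_root s r + b * simple_root t r)"
      using act_alt_nonneg[OF S st] by metis
    have "act w (simple_root s) = (\<lambda>r. a * act v (simple_root s) r + b * act v (simple_root t) r)"
      using v S ab by (simp add: act_mult V_simple_root act_comb)
    moreover have "0 \<le> act v (simple_root s) r" "0 \<le> act v (simple_root t) r"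
      using v(1,3) S up k' by (auto intro!: less.hyps)
    ultimately show ?thesis using ab by simp
  qed
qed


section \<open>Roots and their signs\<close>

lemma act_S_simple_root [simp]:
  "w \<in> carrier W \<Longrightarrow> s \<in> S \<Longrightarrow> act (w \<otimes> s) (simple_root s) = (\<lambda>t. - act w (simple_root s) t)"
  by (simp add: act_mult S_carrier V_simple_root sigma_simple_root act_uminus)

lemma act_inj: "w \<in> carrier W \<Longrightarrow> u \<in> V \<Longrightarrow> v \<in> V \<Longrightarrow> act w u = act w v \<Longrightarrow> u = v"
  by (metis act_inv_act)

abbreviation R where "R \<equiv> roots W S"

abbreviation Pos where "Pos \<equiv> pos_roots W S"

lemma rootE:
  assumes "\<gamma> \<in> R"
  obtains w s where "w \<in> carrier W" "s \<in> S" "\<gamma> = act w (simple_root s)"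
  using assms by (auto simp: roots_def)

lemma act_simple_root_in_R: "w \<in> carrier W \<Longrightarrow> s \<in> S \<Longrightarrow> act w (simple_root s) \<in> R"
  by (auto simp: roots_def)

lemma simple_root_in_Pos: "s \<in> S \<Longrightarrow> simple_root s \<in> Pos"
  using act_simple_root_in_R[of \<one> s] by (simp add: pos_roots_def V_simple_root) (simp add: simple_root_def)

lemma root_in_V: "\<gamma> \<in> R \<Longrightarrow> \<gamma> \<in> V"
  by (auto elim!: rootE simp: V_simple_root)

lemma act_R: "w \<in> carrier W \<Longrightarrow> \<gamma> \<in> R \<Longrightarrow> act w \<gamma> \<in> R"
  by (auto elim!: rootE simp: V_simple_root simp flip: act_mult intro!: act_simple_root_in_R)

lemma uminus_R: "\<gamma> \<in> R \<Longrightarrow> (\<lambda>t. - \<gamma> t) \<in> R"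
  by (auto elim!: rootE simp: S_carrier simp flip: act_S_simple_root intro!: act_simple_root_in_R)

lemma root_norm: "\<gamma> \<in> R \<Longrightarrow> cox_B W \<gamma> \<gamma> = 1"
  by (auto elim!: rootE simp: V_simple_root act_isometry cox_B0_same)

lemma root_nonzero: "\<gamma> \<in> R \<Longrightarrow> \<gamma> \<noteq> (\<lambda>t. 0)"
  using root_norm[of \<gamma>] by (auto simp: cox_B_def)

lemma PosD: "\<gamma> \<in> Pos \<Longrightarrow> \<gamma> \<in> R" "\<gamma> \<in> Pos \<Longrightarrow> 0 \<le> \<gamma> t"
  by (auto simp: pos_roots_def)

lemma act_simple_root_nonpos:
  assumes "w \<in> carrier W" "s \<in> S" "len (w \<otimes> s) \<le> len w"
  shows "act w (simple_root s) r \<le> 0"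
  using act_simple_root_nonneg[of "w \<otimes> s" s r] assms by (simp add: S_carrier)

lemma root_pos_or_neg:
  assumes "\<gamma> \<in> R"
  shows "\<gamma> \<in> Pos \<or> (\<lambda>t. - \<gamma> t) \<in> Pos"
proof -
  obtain w s where ws: "w \<in> carrier W" "s \<in> S" "\<gamma> = act w (simple_root s)"
    using assms by (rule rootE)
  then have "(\<forall>r. 0 \<le> \<gamma> r) \<or> (\<forall>r. \<gamma> r \<le> 0)"
    using act_simple_root_nonneg[of w s] act_simple_root_nonpos[of w s] by (metis linear)
  then show ?thesis using assms uminus_R by (auto simp: pos_roots_def)
qed

lemma not_pos_and_neg: "\<gamma> \<in> Pos \<Longrightarrow> (\<lambda>t. - \<gamma> t) \<notin> Pos"
  using root_nonzero[of \<gamma>] by (auto simp: pos_roots_def fun_eq_iff intro: antisym)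

lemma not_Pos_uminus: "\<gamma> \<in> R \<Longrightarrow> \<gamma> \<notin> Pos \<longleftrightarrow> (\<lambda>t. - \<gamma> t) \<in> Pos"
  using root_pos_or_neg not_pos_and_neg by blast

text \<open>A nontrivial element has a right descent, and it sends the simple root of that descent
  to a negative root.\<close>

lemma act_faithful:
  assumes "w \<in> carrier W" "\<And>s. s \<in> S \<Longrightarrow> act w (simple_root s) \<in> Pos"
  shows "w = \<one>"
proof (rule ccontr)
  assume "w \<noteq> \<one>"
  then obtain t where t: "t \<in> S" "len (w \<otimes> t) < len w" using assms descent_exists by blast
  then have "(\<lambda>r. - act w (simple_root t) r) \<in> Pos"
    using act_simple_root_nonpos[of w t] assms(1)
    by (auto simp: pos_roots_def intro: uminus_R act_simple_root_in_R)
  then show False using assms t not_pos_and_neg by blast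
qed

lemma descent_neg:
  assumes "w \<in> carrier W" "s \<in> S" "act w (simple_root s) \<notin> Pos"
  shows "len (w \<otimes> s) < len w"
  using assms act_simple_root_nonneg[of w s] act_simple_root_in_R[of w s]
  by (force simp: pos_roots_def)

lemma Pos_multiple_simple:
  assumes "\<gamma> \<in> Pos" "s \<in> S" "supp \<gamma> \<subseteq> {s}"
  shows "\<gamma> = simple_root s"
proof -
  have "cox_B W \<gamma> \<gamma> = \<gamma> s * \<gamma> s"
    using cox_B_superset[of "{s}" \<gamma> \<gamma>] assms by (simp add: cox_B0_same)
  then have "\<gamma> s * \<gamma> s = 1"
    using root_norm PosD assms(1) by simp
  then have "\<gamma> s = 1"
    using PosD(2)[OF assms(1), of s] by (auto simp: square_eq_1_iff)
  moreover have "\<gamma> t = 0" if "t \<noteq> s" for t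
    using assms(3) that by (auto simp: supp_def)
  ultimately show ?thesis by (auto simp: simple_root_def)
qed

text \<open>The reflection changes only the coordinate at \<open>s\<close>. A positive root other
  than \<open>simple_root s\<close> has another positive coordinate, because roots have norm 1, and
  one positive coordinate forces a root to be positive.\<close>

lemma S_permutes_Pos:
  assumes "\<gamma> \<in> Pos" "s \<in> S" "\<gamma> \<noteq> simple_root s"
  shows "act s \<gamma> \<in> Pos"
proof -
  have V: "\<gamma> \<in> V" using assms PosD root_in_V by blast
  obtain t where t: "t \<noteq> s" "\<gamma> t \<noteq> 0"
    using Pos_multiple_simple[OF assms(1,2)] assms(3) by (auto simp: supp_def)
  then have "0 < act s \<gamma> t"
    using PosD(2)[OF assms(1), of t] V assms(2) by (simp add: sigma_def simple_root_def)
  then have "(\<lambda>r. - act s \<gamma> r) \<notin> Pos"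
    using PosD(2)[of "\<lambda>r. - act s \<gamma> r" t] by auto
  moreover have "act s \<gamma> \<in> R" using act_R assms PosD S_carrier by blast
  ultimately show ?thesis using root_pos_or_neg by blast
qed

section \<open>Inversion sets and faithfulness\<close>

definition inversions :: "'a \<Rightarrow> ('a \<Rightarrow> real) set" where
  "inversions w = {\<gamma> \<in> Pos. act w \<gamma> \<notin> Pos}"

text \<open>A simple reflection makes only its own simple root negative, so each further letter on
  the left adds at most one inversion.\<close>

lemma finite_inversions:
  assumes "w \<in> carrier W"
  shows "finite (inversions w)"
proof -
  have "finite (inversions (word_prod W l))" if "set l \<subseteq> S" for l
    using that
  proof (induction l)
    case Nil
    have "inversions \<one> = {}" by (auto simp: inversions_def PosD root_in_V)
    then show ?case by simp
  next
    case (Cons s l)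
    let ?w = "word_prod W l"
    have w: "?w \<in> carrier W" "s \<in> S" using Cons by auto
    have "inversions (s \<otimes> ?w) \<subseteq> insert (act (inv ?w) (simple_root s)) (inversions ?w)"
    proof
      fix \<gamma> assume g: "\<gamma> \<in> inversions (s \<otimes> ?w)"
      then have V: "\<gamma> \<in> V" "\<gamma> \<in> Pos" by (auto simp: inversions_def PosD root_in_V)
      then have "act s (act ?w \<gamma>) \<notin> Pos"
        using g w by (simp add: inversions_def act_mult S_carrier)
      then have "act ?w \<gamma> \<notin> Pos \<or> act ?w \<gamma> = simple_root s"
        using S_permutes_Pos w by blast
      then show "\<gamma> \<in> insert (act (inv ?w) (simple_root s)) (inversions ?w)"
      proof
        assume "act ?w \<gamma> = simple_root s"
        then have "\<gamma> = act (inv ?w) (simple_root s)"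
          using act_inv_act[OF w(1) V(1)] by simp
        then show ?thesis by simp
      qed (use V in \<open>simp add: inversions_def\<close>)
    qed
    moreover have "finite (inversions ?w)" using Cons by simp
    ultimately show ?case by (simp add: finite_subset)
  qed
  moreover obtain l where "set l \<subseteq> S" "word_prod W l = w"
    using assms word_exists by blast
  ultimately show ?thesis by blast
qed

text \<open>If the inversion sets agree, then \<open>w\<close> and \<open>u\<close> give the same
  sign to every root, so \<open>w \<otimes> inv u\<close> preserves positivity and faithfulness
  applies.\<close>

lemma inversions_inj:
  assumes "w \<in> carrier W" "u \<in> carrier W" "inversions w = inversions u"
  shows "w = u"
proof -
  have "act (w \<otimes> inv u) \<gamma> \<in> Pos" if g: "\<gamma> \<in> Pos" for \<gamma>
  proof -
    define \<delta> where "\<delta> = act (inv u) \<gamma>"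
    have d: "\<delta> \<in> R" "act u \<delta> = \<gamma>" and eq: "act (w \<otimes> inv u) \<gamma> = act w \<delta>"
      using g assms PosD root_in_V act_R by (auto simp: \<delta>_def act_mult)
    show ?thesis
    proof (cases "\<delta> \<in> Pos")
      case True
      then have "\<delta> \<notin> inversions u" using d g by (simp add: inversions_def)
      then show ?thesis using assms True eq by (auto simp: inversions_def)
    next
      case False
      define \<epsilon> where "\<epsilon> = (\<lambda>t. - \<delta> t)"
      have e: "\<epsilon> \<in> Pos" using False d not_Pos_uminus by (simp add: \<epsilon>_def)
      have "act u \<epsilon> = (\<lambda>t. - \<gamma> t)" using d assms root_in_V by (simp add: \<epsilon>_def act_uminus)
      then have "\<epsilon> \<in> inversions u" using e g not_pos_and_neg by (simp add: inversions_def)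
      then have "act w \<epsilon> \<notin> Pos" using assms by (auto simp: inversions_def)
      then have "(\<lambda>t. - act w \<delta> t) \<notin> Pos" using d assms root_in_V by (simp add: \<epsilon>_def act_uminus)
      then show ?thesis using eq d assms act_R root_pos_or_neg by metis
    qed
  qed
  then have "w \<otimes> inv u = \<one>"
    using assms simple_root_in_Pos by (intro act_faithful) auto
  then show ?thesis using assms by (metis inv_closed inv_equality inv_inv)
qed

lemma act_eq_imp_eq:
  assumes "w \<in> carrier W" "u \<in> carrier W" "\<And>v. v \<in> V \<Longrightarrow> act w v = act u v"
  shows "w = u"
  using assms root_in_V PosD by (intro inversions_inj) (auto simp: inversions_def)

lemma act_conj_reflection:
  assumes "w \<in> carrier W" "s \<in> S" "v \<in> V"
  shows "act (w \<otimes> s \<otimes> inv w) v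
    = (\<lambda>t. 1 * v t + (- 2 * cox_B W (act w (simple_root s)) v) * act w (simple_root s) t)"
proof -
  have "cox_B W (simple_root s) (act (inv w) v) = cox_B W (act w (simple_root s)) v"
    using act_isometry[of w "simple_root s" "act (inv w) v"] assms by (simp add: V_simple_root)
  then have "sigma W s (act (inv w) v)
      = (\<lambda>t. 1 * act (inv w) v t + (- 2 * cox_B W (act w (simple_root s)) v) * simple_root s t)"
    by (simp add: sigma_eq)
  moreover have "act (w \<otimes> s \<otimes> inv w) v = act w (sigma W s (act (inv w) v))"
    using assms by (simp add: act_mult S_carrier)
  ultimately show ?thesis
    using assms act_comb[of w "act (inv w) v" "simple_root s" 1 "- 2 * cox_B W (act w (simple_root s)) v"]
    by (simp add: V_simple_root)
qed

text \<open>The choice in \<open>refl_of\<close> is harmless: the conjugate acts by a formula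
  involving only the root, and an element is determined by its action.\<close>

lemma refl_of_act:
  assumes "w \<in> carrier W" "s \<in> S"
  shows "refl_of W S (act w (simple_root s)) = w \<otimes> s \<otimes> inv w"
  unfolding refl_of_def
proof (rule some_equality)
  fix r
  assume "\<exists>u\<in>carrier W. \<exists>t\<in>S. act w (simple_root s) = act u (simple_root t) \<and> r = u \<otimes> t \<otimes> inv u"
  then obtain u t where ut: "u \<in> carrier W" "t \<in> S" "act w (simple_root s) = act u (simple_root t)"
    "r = u \<otimes> t \<otimes> inv u" by blast
  have "u \<otimes> t \<otimes> inv u = w \<otimes> s \<otimes> inv w"
    using assms ut(1,2) by (intro act_eq_imp_eq) (auto simp: S_carrier act_conj_reflection ut(3))
  then show "r = w \<otimes> s \<otimes> inv w" using ut by simp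
qed (use assms in blast)

lemma refl_of_closed: "\<gamma> \<in> R \<Longrightarrow> refl_of W S \<gamma> \<in> carrier W"
  by (auto elim!: rootE simp: refl_of_act S_carrier)

lemma act_refl_of:
  assumes "\<gamma> \<in> R" "v \<in> V"
  shows "act (refl_of W S \<gamma>) v = (\<lambda>t. 1 * v t + (- 2 * cox_B W \<gamma> v) * \<gamma> t)"
  using assms by (auto elim!: rootE simp: refl_of_act act_conj_reflection)

lemma refl_of_self: "\<gamma> \<in> R \<Longrightarrow> act (refl_of W S \<gamma>) \<gamma> = (\<lambda>t. - \<gamma> t)"
  by (simp add: act_refl_of root_in_V root_norm)


subsection \<open>Functionals and their stabilizers\<close>

text \<open>Points of the dual of \<open>V\<close>, where chambers live even if the form is
  degenerate. Values outside \<open>V\<close> are left arbitrary, so precomposition with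
  \<open>act w\<close> needs no correction there.\<close>

definition functional :: "(('a \<Rightarrow> real) \<Rightarrow> real) \<Rightarrow> bool" where
  "functional f \<longleftrightarrow> (\<forall>u\<in>V. \<forall>v\<in>V. \<forall>a b. f (\<lambda>t. a * u t + b * v t) = a * f u + b * f v)"

lemma functional_comb:
  "functional f \<Longrightarrow> u \<in> V \<Longrightarrow> v \<in> V \<Longrightarrow> f (\<lambda>t. a * u t + b * v t) = a * f u + b * f v"
  by (simp add: functional_def)

lemma functional_scale: "functional f \<Longrightarrow> u \<in> V \<Longrightarrow> f (\<lambda>t. a * u t) = a * f u"
  using functional_comb[of f u u a 0] by simp

lemma functional_uminus: "functional f \<Longrightarrow> u \<in> V \<Longrightarrow> f (\<lambda>t. - u t) = - f u"
  using functional_scale[of f u "-1"] by simp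

lemma functional_sum:
  assumes f: "functional f" and I: "finite I" "\<And>i. i \<in> I \<Longrightarrow> x i \<in> V"
  shows "f (\<lambda>t. \<Sum>i\<in>I. c i * x i t) = (\<Sum>i\<in>I. c i * f (x i))"
  using I
proof (induction I rule: finite_induct)
  case empty
  then show ?case using functional_scale[OF f V_zero, of 0] by simp
next
  case (insert i I)
  then have "f (\<lambda>t. c i * x i t + 1 * (\<Sum>i\<in>I. c i * x i t)) = c i * f (x i) + 1 * f (\<lambda>t. \<Sum>i\<in>I. c i * x i t)"
    by (intro functional_comb f V_sum) auto
  then show ?case using insert by simp
qed

lemma functional_expand:
  assumes "functional f" "v \<in> V"
  shows "f v = (\<Sum>s\<in>supp v. v s * f (simple_root s))"
proof -
  have "f (\<lambda>t. \<Sum>s\<in>supp v. v s * simple_root s t) = (\<Sum>s\<in>supp v. v s * f (simple_root s))"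
    using assms by (intro functional_sum) (auto simp: V_def)
  then show ?thesis using V_expand[OF assms(2)] by simp
qed

lemma functional_act:
  assumes "functional f" "w \<in> carrier W"
  shows "functional (\<lambda>v. f (act w v))"
  using assms by (simp add: functional_def act_comb)

definition dominant :: "(('a \<Rightarrow> real) \<Rightarrow> real) \<Rightarrow> bool" where
  "dominant f \<longleftrightarrow> functional f \<and> (\<forall>s\<in>S. 0 \<le> f (simple_root s))"

lemma dominant_Pos:
  assumes "dominant f" "\<gamma> \<in> Pos"
  shows "0 \<le> f \<gamma>"
proof -
  have "\<gamma> \<in> V" using assms PosD root_in_V by blast
  then show ?thesis
    using assms PosD(2)[OF assms(2)] functional_expand[of f \<gamma>]
    by (auto simp: dominant_def V_def intro!: sum_nonneg)
qed

lemma dominant_Pos_zero: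
  assumes "dominant f" "\<gamma> \<in> Pos" "f \<gamma> = 0" "s \<in> supp \<gamma>"
  shows "f (simple_root s) = 0"
proof -
  have V: "\<gamma> \<in> V" using assms PosD root_in_V by blast
  have "finite (supp \<gamma>)" using V by (simp add: V_def)
  moreover have "0 \<le> \<gamma> i * f (simple_root i)" if "i \<in> supp \<gamma>" for i
    using that V assms(1) PosD(2)[OF assms(2), of i] by (auto simp: V_def dominant_def)
  moreover have "(\<Sum>s\<in>supp \<gamma>. \<gamma> s * f (simple_root s)) = 0"
    using functional_expand[of f \<gamma>] V assms by (simp add: dominant_def)
  ultimately have "\<gamma> s * f (simple_root s) = 0"
    using assms(4) sum_nonneg_eq_0_iff[of "supp \<gamma>" "\<lambda>i. \<gamma> i * f (simple_root i)"] by blast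
  then show ?thesis using assms(4) by (simp add: supp_def)
qed

text \<open>The codomain is arbitrary because the notion serves both real functionals and the
  vector-valued averaging operator, whose stabilizers are compared later.\<close>

definition stab :: "(('a \<Rightarrow> real) \<Rightarrow> 'c) \<Rightarrow> 'a set" where
  "stab f = {w \<in> carrier W. \<forall>v\<in>V. f (act w v) = f v}"

lemma subgroup_stab: "subgroup (stab f) W"
proof (rule subgroupI)
  show "stab f \<noteq> {}" using one_closed by (auto simp: stab_def intro: exI[of _ \<one>])
  show "inv w \<in> stab f" if "w \<in> stab f" for w
    using that by (auto simp: stab_def) (metis act_act_inv act_closed inv_closed)
qed (auto simp: stab_def act_mult)

lemma stab_act:
  assumes "u \<in> stab f" "w \<in> carrier W"
  shows "inv w \<otimes> u \<otimes> w \<in> stab (\<lambda>v. f (act w v))"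
  using assms by (simp add: stab_def act_mult)

lemma refl_of_in_stab:
  assumes "functional f" "\<gamma> \<in> R" "f \<gamma> = 0"
  shows "refl_of W S \<gamma> \<in> stab f"
proof -
  have "f (act (refl_of W S \<gamma>) v) = f v" if "v \<in> V" for v
    using functional_comb[OF assms(1) that root_in_V[OF assms(2)], of 1 "- 2 * cox_B W \<gamma> v"] assms that
    by (simp add: act_refl_of)
  then show ?thesis using assms by (simp add: stab_def refl_of_closed)
qed

text \<open>A descent sends \<open>simple_root s\<close> to a negative root, where the dominant
  \<open>f\<close> is at most 0; as \<open>w\<close> fixes \<open>f\<close>, the same value is taken
  at \<open>simple_root s\<close>, where it is at least 0.\<close>

lemma stab_descent:
  assumes "dominant f" "w \<in> stab f" "w \<noteq> \<one>"
  obtains s where "s \<in> S" "f (simple_root s) = 0" "len (w \<otimes> s) < len w"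
proof -
  have w: "w \<in> carrier W" using assms by (simp add: stab_def)
  obtain s where s: "s \<in> S" "len (w \<otimes> s) < len w" using descent_exists[OF w assms(3)] by blast
  let ?\<gamma> = "act w (simple_root s)"
  have g: "?\<gamma> \<in> R" using w s by (simp add: act_simple_root_in_R)
  have "(\<lambda>t. - ?\<gamma> t) \<in> Pos"
    using act_simple_root_nonpos[OF w s(1)] s(2) uminus_R[OF g] by (simp add: pos_roots_def)
  then have "0 \<le> - f ?\<gamma>"
    using dominant_Pos[OF assms(1)] functional_uminus[of f ?\<gamma>] root_in_V[OF g] assms(1)
    by (fastforce simp: dominant_def)
  moreover have "f ?\<gamma> = f (simple_root s)"
    using assms s by (simp add: stab_def V_simple_root)
  moreover have "0 \<le> f (simple_root s)" using assms s by (simp add: dominant_def)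
  ultimately show ?thesis using that[of s] s by simp
qed

lemma simple_in_stab:
  assumes "functional f" "s \<in> S" "f (simple_root s) = 0"
  shows "s \<in> stab f"
  using refl_of_in_stab[of f "simple_root s"] refl_of_act[of \<one> s] assms simple_root_in_Pos PosD
  by (simp add: V_simple_root S_carrier)

lemma stab_dominant:
  assumes "dominant f"
  shows "stab f \<subseteq> generate W {s \<in> S. f (simple_root s) = 0}"
proof
  fix w assume "w \<in> stab f"
  then show "w \<in> generate W {s \<in> S. f (simple_root s) = 0}"
  proof (induction "len w" arbitrary: w rule: less_induct)
    case less
    show ?case
    proof (cases "w = \<one>")
      case False
      then obtain s where s: "s \<in> S" "f (simple_root s) = 0" "len (w \<otimes> s) < len w"
        using stab_descent assms less.prems by blast
      have "s \<in> stab f" using s assms by (simp add: simple_in_stab dominant_def)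
      then have "w \<otimes> s \<in> stab f" using less.prems subgroup_stab by (blast intro: subgroup.m_closed)
      then have "w \<otimes> s \<in> generate W {s \<in> S. f (simple_root s) = 0}" using less s by blast
      moreover have "s \<in> generate W {s \<in> S. f (simple_root s) = 0}"
        using s by (intro generate.incl) auto
      ultimately have "w \<otimes> s \<otimes> s \<in> generate W {s \<in> S. f (simple_root s) = 0}"
        by (rule generate.eng)
      then show ?thesis using s less.prems by (simp add: stab_def)
    qed (simp add: generate.one)
  qed
qed

text \<open>For \<open>w\<close> in the stabilizer and an inversion \<gamma>, the value at \<gamma>
  equals that at the negative root \<open>act w \<gamma>\<close>, hence is at most 0. So all
  inversion sets lie in one finite set, and they determine the elements.\<close>

lemma finite_stab:
  assumes "dominant f" "finite {\<gamma> \<in> Pos. f \<gamma> \<le> 0}"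
  shows "finite (stab f)"
proof (rule finite_imageD)
  have "inversions w \<subseteq> {\<gamma> \<in> Pos. f \<gamma> \<le> 0}" if w: "w \<in> stab f" for w
  proof
    fix \<gamma> assume g: "\<gamma> \<in> inversions w"
    then have gR: "\<gamma> \<in> Pos" "\<gamma> \<in> V" "\<gamma> \<in> R" by (auto simp: inversions_def PosD root_in_V)
    have wc: "w \<in> carrier W" using w by (simp add: stab_def)
    have wg: "act w \<gamma> \<in> R" using gR wc by (simp add: act_R)
    then have "(\<lambda>t. - act w \<gamma> t) \<in> Pos"
      using g not_Pos_uminus by (simp add: inversions_def)
    then have "0 \<le> - f (act w \<gamma>)"
      using dominant_Pos[OF assms(1)] functional_uminus[of f "act w \<gamma>"] root_in_V[OF wg] assms(1)
      by (fastforce simp: dominant_def)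
    then show "\<gamma> \<in> {\<gamma> \<in> Pos. f \<gamma> \<le> 0}" using w gR by (simp add: stab_def)
  qed
  then have "inversions ` stab f \<subseteq> Pow {\<gamma> \<in> Pos. f \<gamma> \<le> 0}" by blast
  then show "finite (inversions ` stab f)" using assms finite_subset by blast
  show "inj_on inversions (stab f)" by (rule inj_onI) (auto simp: stab_def intro: inversions_inj)
qed

text \<open>Reflecting in a simple root on which \<open>f\<close> is negative permutes the other
  positive roots, so the number of positive roots with negative value drops. Finiteness is carried
  for nonpositive values, zeros included, since finiteness of the stabilizer depends on the
  zeros.\<close>

lemma dominant_translate:
  assumes "functional f" "finite {\<gamma> \<in> Pos. f \<gamma> \<le> 0}"
  shows "\<exists>w\<in>carrier W. dominant (\<lambda>v. f (act w v)) \<and> finite {\<gamma> \<in> Pos. f (act w \<gamma>) \<le> 0}"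
  using assms
proof (induction "card {\<gamma> \<in> Pos. f \<gamma> < 0}" arbitrary: f rule: less_induct)
  case less
  show ?case
  proof (cases "dominant f")
    case True
    moreover have "{\<gamma> \<in> Pos. f (act \<one> \<gamma>) \<le> 0} = {\<gamma> \<in> Pos. f \<gamma> \<le> 0}"
      by (auto simp: PosD root_in_V)
    ultimately show ?thesis
      using less.prems functional_act[of f \<one>]
      by (intro bexI[of _ \<one>]) (auto simp: dominant_def V_simple_root)
  next
    case False
    then obtain s where s: "s \<in> S" "f (simple_root s) < 0"
      using less.prems by (auto simp: dominant_def not_le)
    have sV: "simple_root s \<in> V" and sc: "s \<in> carrier W" using s by (auto simp: V_simple_root S_carrier)
    define g where "g = (\<lambda>v. f (act s v))"
    have g: "functional g" using less.prems s by (simp add: g_def functional_act S_carrier)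
    have ss: "act s (act s v) = v" if "v \<in> V" for v using that s by simp
    have gs: "g (simple_root s) > 0"
      using s sV less.prems by (simp add: g_def sigma_simple_root functional_uminus)
    have neg: "act s \<gamma> \<in> Pos" if "\<gamma> \<in> Pos" "\<gamma> \<noteq> simple_root s" for \<gamma>
      using S_permutes_Pos that s by blast
    let ?A = "{\<gamma> \<in> Pos. f \<gamma> < 0}" and ?B = "{\<gamma> \<in> Pos. g \<gamma> < 0}"
    have finA: "finite ?A" by (rule finite_subset[OF _ less.prems(2)]) auto
    have sub: "act s ` ?B \<subseteq> ?A - {simple_root s}"
    proof clarify
      fix \<gamma> assume gg: "\<gamma> \<in> Pos" "g \<gamma> < 0"
      then have ne: "\<gamma> \<noteq> simple_root s" using gs by auto
      moreover have "act s \<gamma> \<noteq> simple_root s"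
      proof
        assume "act s \<gamma> = simple_root s"
        then have "\<gamma> = (\<lambda>t. - simple_root s t)"
          using ss[of \<gamma>] gg s sV by (simp add: PosD root_in_V sigma_simple_root)
        then show False using gg simple_root_in_Pos[OF s(1)] not_pos_and_neg by blast
      qed
      ultimately show "act s \<gamma> \<in> ?A - {simple_root s}"
        using gg neg by (simp add: g_def)
    qed
    have inj: "inj_on (act s) ?B"
      by (rule inj_onI) (metis (mono_tags, lifting) PosD(1) root_in_V mem_Collect_eq ss)
    have "card ?B = card (act s ` ?B)" using inj by (simp add: card_image)
    also have "\<dots> \<le> card (?A - {simple_root s})" using sub finA by (intro card_mono) auto
    also have "\<dots> < card ?A"
      using s finA simple_root_in_Pos by (intro psubset_card_mono) auto
    finally have lt: "card ?B < card ?A" .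
    have "{\<gamma> \<in> Pos. g \<gamma> \<le> 0} \<subseteq> act s ` {\<gamma> \<in> Pos. f \<gamma> \<le> 0}"
    proof clarify
      fix \<gamma> assume gg: "\<gamma> \<in> Pos" "g \<gamma> \<le> 0"
      then have "act s \<gamma> \<in> Pos" using gs neg by force
      then show "\<gamma> \<in> act s ` {\<gamma> \<in> Pos. f \<gamma> \<le> 0}"
        using gg ss[of \<gamma>] by (intro image_eqI[of _ _ "act s \<gamma>"]) (simp_all add: g_def PosD root_in_V)
    qed
    then have "finite {\<gamma> \<in> Pos. g \<gamma> \<le> 0}" using less.prems finite_subset by blast
    then obtain w where w: "w \<in> carrier W" "dominant (\<lambda>v. g (act w v))" "finite {\<gamma> \<in> Pos. g (act w \<gamma>) \<le> 0}"
      using less.hyps[OF lt g] by blast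
    have eq: "g (act w v) = f (act (s \<otimes> w) v)" if "v \<in> V" for v
      using that w sc by (simp add: g_def act_mult)
    have "{\<gamma> \<in> Pos. g (act w \<gamma>) \<le> 0} = {\<gamma> \<in> Pos. f (act (s \<otimes> w) \<gamma>) \<le> 0}"
      using eq by (auto simp: PosD root_in_V)
    moreover have "dominant (\<lambda>v. f (act (s \<otimes> w) v))"
      using w(1,2) sc less.prems(1) functional_act[of f "s \<otimes> w"] by (auto simp: dominant_def eq V_simple_root)
    ultimately show ?thesis using w sc by (intro bexI[of _ "s \<otimes> w"]) auto
  qed
qed

lemma generate_conj:
  assumes "x \<in> generate W J" "J \<subseteq> carrier W" "w \<in> carrier W"
  shows "w \<otimes> x \<otimes> inv w \<in> generate W ((\<lambda>s. w \<otimes> s \<otimes> inv w) ` J)"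
  using assms(1)
proof induction
  case one
  then show ?case using assms generate.one[of W] by simp
next
  case (incl h)
  then show ?case by (auto intro: generate.incl)
next
  case (inv h)
  then have "inv (w \<otimes> h \<otimes> inv w) \<in> generate W ((\<lambda>s. w \<otimes> s \<otimes> inv w) ` J)"
    by (intro generate.inv) auto
  moreover have "inv (w \<otimes> h \<otimes> inv w) = w \<otimes> inv h \<otimes> inv w"
    using assms inv by (simp add: inv_mult_group m_assoc subsetD)
  ultimately show ?case by simp
next
  case (eng h1 h2)
  have "h1 \<in> carrier W" "h2 \<in> carrier W"
    using eng assms generate_in_carrier by blast+
  then have "w \<otimes> (h1 \<otimes> h2) \<otimes> inv w = (w \<otimes> h1 \<otimes> inv w) \<otimes> (w \<otimes> h2 \<otimes> inv w)"
    using assms by (simp add: m_assoc inv_solve_left)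
  then show ?case using eng by (simp add: generate.eng)
qed

text \<open>Among all \<open>w\<close> making \<open>f \<circ> w\<close> dominant, one of minimal length maps the simple roots
  fixed by the stabilizer to positive roots.\<close>
lemma stab_parabolic:
  assumes f: "functional f" "finite {\<gamma> \<in> Pos. f \<gamma> \<le> 0}"
  obtains w where "w \<in> carrier W" "dominant (\<lambda>v. f (act w v))" "finite (stab f)"
    "\<forall>s\<in>S. f (act w (simple_root s)) = 0 \<longrightarrow> act w (simple_root s) \<in> Pos"
    "stab f \<subseteq> generate W ((\<lambda>s. w \<otimes> s \<otimes> inv w) ` {s \<in> S. f (act w (simple_root s)) = 0})"
proof -
  define P where "P w \<longleftrightarrow> w \<in> carrier W \<and> dominant (\<lambda>v. f (act w v))
    \<and> finite {\<gamma> \<in> Pos. f (act w \<gamma>) \<le> 0}" for w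
  have "\<exists>w. P w" using dominant_translate[OF f] by (auto simp: P_def)
  then obtain w where w: "P w" "\<And>u. P u \<Longrightarrow> len w \<le> len u"
    using ex_has_least_nat[of P _ len] by blast
  then have wc: "w \<in> carrier W" and dom: "dominant (\<lambda>v. f (act w v))" and
    fin: "finite {\<gamma> \<in> Pos. f (act w \<gamma>) \<le> 0}" by (auto simp: P_def)
  let ?f = "\<lambda>v. f (act w v)"
  have funl: "functional ?f" using dom by (simp add: dominant_def)
  have conj: "inv w \<otimes> u \<otimes> w \<in> stab ?f" if "u \<in> stab f" for u
    using stab_act that wc by blast
  have u_eq: "w \<otimes> (inv w \<otimes> u \<otimes> w) \<otimes> inv w = u" if "u \<in> carrier W" for u
    using that wc by (simp add: m_assoc) (simp add: m_assoc [symmetric])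
  have "stab f \<subseteq> (\<lambda>x. w \<otimes> x \<otimes> inv w) ` stab ?f"
  proof
    fix u assume "u \<in> stab f"
    then show "u \<in> (\<lambda>x. w \<otimes> x \<otimes> inv w) ` stab ?f"
      using conj u_eq[of u] by (intro image_eqI[of _ _ "inv w \<otimes> u \<otimes> w"]) (auto simp: stab_def)
  qed
  then have "finite (stab f)" using finite_stab[OF dom fin] finite_subset by blast
  moreover have "act w (simple_root s) \<in> Pos" if s: "s \<in> S" "?f (simple_root s) = 0" for s
  proof (rule ccontr)
    assume "act w (simple_root s) \<notin> Pos"
    then have "len (w \<otimes> s) < len w" using descent_neg wc s by blast
    have eq: "f (act (w \<otimes> s) v) = f (act w v)" if "v \<in> V" for v
      using simple_in_stab[OF funl s] that wc s by (simp add: stab_def act_mult S_carrier)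
    have "{\<gamma> \<in> Pos. f (act (w \<otimes> s) \<gamma>) \<le> 0} = {\<gamma> \<in> Pos. f (act w \<gamma>) \<le> 0}"
      using eq by (auto simp: PosD root_in_V)
    moreover have "dominant (\<lambda>v. f (act (w \<otimes> s) v))"
      using dom functional_act[of f "w \<otimes> s"] wc s f by (simp add: dominant_def eq V_simple_root S_carrier del: act_S_simple_root)
    ultimately have "P (w \<otimes> s)" using wc s fin by (simp add: P_def S_carrier)
    then show False using w(2) \<open>len (w \<otimes> s) < len w\<close> by force
  qed
  moreover have "stab f \<subseteq> generate W ((\<lambda>s. w \<otimes> s \<otimes> inv w) ` {s \<in> S. ?f (simple_root s) = 0})"
  proof
    fix u assume u: "u \<in> stab f"
    then have "inv w \<otimes> u \<otimes> w \<in> generate W {s \<in> S. ?f (simple_root s) = 0}"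
      using conj stab_dominant[OF dom] by blast
    from generate_conj[OF this _ wc] u u_eq[of u]
    show "u \<in> generate W ((\<lambda>s. w \<otimes> s \<otimes> inv w) ` {s \<in> S. ?f (simple_root s) = 0})"
      by (auto simp: stab_def S_carrier subset_iff)
  qed
  ultimately show ?thesis using that wc dom by blast
qed


subsection \<open>Averaging over a finite subgroup\<close>

text \<open>Up to the omitted factor 1 / |K|, which affects neither zeros nor stabilizers, this is
  the projection to the \<open>K\<close>-fixed vectors for a finite subgroup \<open>K\<close>. The
  factor 1 matches the shape of the rules for finite combinations.\<close>

definition avg :: "'a set \<Rightarrow> ('a \<Rightarrow> real) \<Rightarrow> 'a \<Rightarrow> real" where
  "avg K v = (\<lambda>t. \<Sum>k\<in>K. 1 * act k v t)"

lemma avg_V: "finite K \<Longrightarrow> K \<subseteq> carrier W \<Longrightarrow> v \<in> V \<Longrightarrow> avg K v \<in> V"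
  unfolding avg_def by (rule V_sum) auto

lemma avg_comb:
  assumes "K \<subseteq> carrier W" "u \<in> V" "v \<in> V"
  shows "avg K (\<lambda>t. a * u t + b * v t) = (\<lambda>t. a * avg K u t + b * avg K v t)"
proof -
  have "avg K (\<lambda>t. a * u t + b * v t) = (\<lambda>t. \<Sum>k\<in>K. a * act k u t + b * act k v t)"
    unfolding avg_def using assms by (intro ext sum.cong) (auto simp: act_comb)
  then show ?thesis by (simp add: avg_def sum.distrib sum_distrib_left)
qed

lemma avg_act:
  assumes K: "subgroup K W" and k: "k \<in> K" and v: "v \<in> V"
  shows "avg K (act k v) = avg K v"
proof -
  have c: "h \<in> K \<Longrightarrow> h \<in> carrier W" for h using subgroup.mem_carrier[OF K] .
  have "bij_betw (\<lambda>h. h \<otimes> k) K K"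
    using c k subgroup.m_closed[OF K] subgroup.m_inv_closed[OF K]
    by (intro bij_betw_byWitness[of _ "\<lambda>h. h \<otimes> inv k"]) (auto simp: m_assoc)
  then have "(\<Sum>h\<in>K. act (h \<otimes> k) v t) = (\<Sum>h\<in>K. act h v t)" for t
    by (rule sum.reindex_bij_betw)
  then show ?thesis using c k v by (simp add: avg_def act_mult)
qed

text \<open>By linearity the inner sum can be taken outside, and the outer average absorbs each
  element of \<open>K\<close>.\<close>

lemma avg_avg:
  assumes K: "subgroup K W" "subgroup K' W" "K \<subseteq> K'" "finite K'" and v: "v \<in> V"
  shows "avg K' (avg K v) = (\<lambda>t. card K * avg K' v t)"
proof -
  have fin: "finite K" using K finite_subset by blast
  have c: "h \<in> K' \<Longrightarrow> h \<in> carrier W" for h using subgroup.mem_carrier[OF K(2)] .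
  have c': "h \<in> K \<Longrightarrow> h \<in> carrier W" for h using c K by blast
  have "avg K' (avg K v) t = (\<Sum>h\<in>K'. \<Sum>k\<in>K. act h (act k v) t)" for t
  proof -
    have "act h (avg K v) = (\<lambda>t. \<Sum>k\<in>K. 1 * act h (act k v) t)" if "h \<in> K'" for h
      unfolding avg_def using fin c c' v that by (intro act_sum) auto
    then show ?thesis by (simp add: avg_def)
  qed
  also have "\<dots> t = (\<Sum>k\<in>K. avg K' (act k v) t)" for t
    by (subst sum.swap) (simp add: avg_def)
  also have "\<dots> t = (\<Sum>k\<in>K. avg K' v t)" for t
    using K v by (intro sum.cong) (auto simp: avg_act)
  finally show ?thesis by auto
qed

text \<open>This is the parabolic closure of \<open>K\<close>. Described as the stabilizer of the averaging
  operator it is visibly monotone in \<open>K\<close>, since \<open>avg K' \<circ> avg K = |K| avg K'\<close> for \<open>K \<subseteq> K'\<close>.\<close>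
abbreviation par_closure :: "'a set \<Rightarrow> 'a set" where
  "par_closure K \<equiv> stab (avg K)"

lemma par_closure_superset: "subgroup K W \<Longrightarrow> K \<subseteq> par_closure K"
  by (auto simp: stab_def avg_act subgroup.mem_carrier)

lemma par_closure_mono:
  assumes K: "subgroup K W" "subgroup K' W" "K \<subseteq> K'" "finite K'"
  shows "par_closure K \<subseteq> par_closure K'"
proof
  fix w assume w: "w \<in> par_closure K"
  have "K \<noteq> {}" "finite K" using K subgroup.one_closed finite_subset by blast+
  then have "card K \<noteq> 0" by simp
  have "avg K' (act w v) = avg K' v" if v: "v \<in> V" for v
  proof -
    have "(\<lambda>t. card K * avg K' (act w v) t) = (\<lambda>t. card K * avg K' v t)"
      using avg_avg[OF K, of v] avg_avg[OF K, of "act w v"] w v by (simp add: stab_def)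
    then show ?thesis using \<open>card K \<noteq> 0\<close> by (simp add: fun_eq_iff)
  qed
  then show "w \<in> par_closure K'" using w by (simp add: stab_def)
qed

section \<open>Generic positive functionals\<close>

definition weight :: "('a \<Rightarrow> real) \<Rightarrow> ('a \<Rightarrow> real) \<Rightarrow> real" where
  "weight \<rho> v = (\<Sum>s\<in>supp v. v s * \<rho> s)"

lemma weight_superset: "finite A \<Longrightarrow> supp v \<subseteq> A \<Longrightarrow> weight \<rho> v = (\<Sum>s\<in>A. v s * \<rho> s)"
  unfolding weight_def by (rule sum.mono_neutral_left) (auto simp: supp_def)

lemma functional_weight: "functional (weight \<rho>)"
  unfolding functional_def
proof (intro ballI allI)
  fix u v a b assume "u \<in> V" "v \<in> V"
  then have A: "finite (supp u \<union> supp v)" by (simp add: V_def)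
  have "supp (\<lambda>t. a * u t + b * v t) \<subseteq> supp u \<union> supp v" by (auto simp: supp_def)
  with A show "weight \<rho> (\<lambda>t. a * u t + b * v t) = a * weight \<rho> u + b * weight \<rho> v"
    by (simp add: weight_superset[of "supp u \<union> supp v"] sum_distrib_left sum.distrib [symmetric] algebra_simps)
qed

lemma weight_Pos:
  assumes "\<And>s. 0 < \<rho> s" "\<gamma> \<in> Pos"
  shows "0 < weight \<rho> \<gamma>"
proof -
  have V: "\<gamma> \<in> V" "\<gamma> \<in> R" using assms PosD root_in_V by blast+
  have ne: "supp \<gamma> \<noteq> {}" using root_nonzero[OF V(2)] by (auto simp: supp_def)
  have "0 < \<gamma> s" if "s \<in> supp \<gamma>" for s
    using PosD(2)[OF assms(2), of s] that by (auto simp: supp_def)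
  with ne V assms(1) show ?thesis unfolding weight_def by (intro sum_pos) (auto simp: V_def)
qed

lemma weight_upd:
  assumes "v \<in> V"
  shows "weight (\<rho>(s := \<rho> s + e)) v = weight \<rho> v + e * v s"
proof -
  have "finite (insert s (supp v))" using assms by (simp add: V_def)
  then have "weight (\<rho>(s := \<rho> s + e)) v = (\<Sum>r\<in>insert s (supp v). v r * \<rho> r + (if r = s then e * v s else 0))"
    by (subst weight_superset[of "insert s (supp v)"]) (auto intro!: sum.cong simp: algebra_simps)
  also have "\<dots> = weight \<rho> v + e * v s"
    using \<open>finite (insert s (supp v))\<close>
    by (subst weight_superset[of "insert s (supp v)"]) (auto simp: sum.distrib simp del: sum.insert_if)
  finally show ?thesis .
qed

text \<open>Finitely many hyperplanes do not cover the positive cone. If the weight found for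
  \<open>X\<close> vanishes on the new vector \<open>v\<close>, it is increased at one coordinate
  where \<open>v\<close> is nonzero.\<close>

lemma generic_weight:
  assumes "finite X" "X \<subseteq> V" "(\<lambda>t. 0) \<notin> X"
  shows "\<exists>\<rho>. (\<forall>s. 0 < \<rho> s) \<and> (\<forall>v\<in>X. weight \<rho> v \<noteq> 0)"
  using assms
proof (induction X rule: finite_induct)
  case empty
  show ?case by (intro exI[of _ "\<lambda>_. 1"]) auto
next
  case (insert v X)
  then obtain \<rho> where r: "\<And>s. 0 < \<rho> s" "\<And>u. u \<in> X \<Longrightarrow> weight \<rho> u \<noteq> 0" by auto
  show ?case
  proof (cases "weight \<rho> v = 0")
    case False
    then show ?thesis using r by auto
  next
    case True
    obtain s where s: "v s \<noteq> 0" using insert.prems by (auto simp: fun_eq_iff)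
    \<comment> \<open>The removed numbers are the increments that would create a zero on some
      \<open>u\<close> in \<open>X\<close>. If \<open>u s = 0\<close> the increment leaves the
      nonzero weight unchanged, so the default quotient by 0 does no harm.\<close>
    have "infinite ({0<..} - (\<lambda>u. - weight \<rho> u / u s) ` X)"
      using insert.hyps infinite_Ioi[of "0::real"] by (simp add: Diff_infinite_finite)
    then obtain e where e: "e > 0" "e \<notin> (\<lambda>u. - weight \<rho> u / u s) ` X"
      by (force dest!: infinite_imp_nonempty)
    have "weight (\<rho>(s := \<rho> s + e)) u \<noteq> 0" if u: "u \<in> X" for u
    proof
      assume "weight (\<rho>(s := \<rho> s + e)) u = 0"
      then have eq: "weight \<rho> u + e * u s = 0" using u insert.prems by (simp add: weight_upd subset_iff)
      with r(2)[OF u] have "u s \<noteq> 0" by auto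
      with eq have "e = - weight \<rho> u / u s" by (simp add: field_simps)
      with e u show False by blast
    qed
    moreover have "weight (\<rho>(s := \<rho> s + e)) v \<noteq> 0"
      using True e s insert.prems by (simp add: weight_upd)
    moreover have "0 < (\<rho>(s := \<rho> s + e)) t" for t
      using r(1)[of t] e(1) by (auto intro: add_pos_pos)
    ultimately show ?thesis by (intro exI[of _ "\<rho>(s := \<rho> s + e)"]) blast
  qed
qed

text \<open>Only the finitely many roots made negative by some element of \<open>K\<close> can be killed by
  the average of a positive functional, so a generic choice kills exactly those with zero average.\<close>
lemma par_closure_eq_stab:
  assumes K: "subgroup K W" "finite K"
  obtains f where "functional f" "finite {\<gamma> \<in> Pos. f \<gamma> \<le> 0}" "par_closure K = stab f"
proof -
  have c: "h \<in> K \<Longrightarrow> h \<in> carrier W" for h using subgroup.mem_carrier[OF K(1)] .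
  have sub: "K \<subseteq> carrier W" using c by blast
  have "K \<noteq> {}" using subgroup.one_closed[OF K(1)] by blast
  define N where "N = (\<Union>k\<in>K. inversions k)"
  have N: "finite N" using K c by (auto simp: N_def finite_inversions)
  have NV: "N \<subseteq> V" by (auto simp: N_def inversions_def PosD root_in_V)
  define X where "X = avg K ` N - {\<lambda>t. 0}"
  have "finite X" "X \<subseteq> V" "(\<lambda>t. 0) \<notin> X" using N NV K sub avg_V by (auto simp: X_def)
  then obtain \<rho> where r: "\<And>s. 0 < \<rho> s" "\<And>v. v \<in> X \<Longrightarrow> weight \<rho> v \<noteq> 0"
    using generic_weight[of X] by auto
  define f where "f = (\<lambda>v. weight \<rho> (avg K v))"
  have f: "functional f"
    unfolding functional_def
  proof (intro ballI allI)
    fix u v a b assume "u \<in> V" "v \<in> V"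
    then show "f (\<lambda>t. a * u t + b * v t) = a * f u + b * f v"
      using functional_comb[OF functional_weight] avg_V[OF K(2) sub]
      by (simp add: f_def avg_comb[OF sub])
  qed
  \<comment> \<open>Outside \<open>N\<close> every element of \<open>K\<close> keeps \<gamma>
    positive, so \<open>f \<gamma>\<close> is a nonempty sum of positive weights.\<close>
  have small: "{\<gamma> \<in> Pos. f \<gamma> \<le> 0} \<subseteq> N"
  proof clarify
    fix \<gamma> assume g: "\<gamma> \<in> Pos" "f \<gamma> \<le> 0"
    show "\<gamma> \<in> N"
    proof (rule ccontr)
      assume "\<gamma> \<notin> N"
      then have "act k \<gamma> \<in> Pos" if "k \<in> K" for k using that g by (auto simp: N_def inversions_def)
      then have "0 < weight \<rho> (act k \<gamma>)" if "k \<in> K" for k using that r weight_Pos by blast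
      then have "0 < (\<Sum>k\<in>K. 1 * weight \<rho> (act k \<gamma>))"
        using K \<open>K \<noteq> {}\<close> by (intro sum_pos) auto
      also have "\<dots> = f \<gamma>"
        unfolding f_def avg_def using K c g
        by (intro functional_sum[OF functional_weight, symmetric]) (auto simp: PosD root_in_V)
      finally show False using g by simp
    qed
  qed
  have fin: "finite {\<gamma> \<in> Pos. f \<gamma> \<le> 0}" using small N finite_subset by blast
  have "par_closure K \<subseteq> stab f" by (auto simp: stab_def f_def)
  \<comment> \<open>The generators of \<open>stab f\<close> are reflections in positive roots with
    value 0. Such a root lies in \<open>N\<close>, so by genericity its average is the zero vector,
    and its reflection changes any vector only by a multiple that averages to 0.\<close>
  moreover have "stab f \<subseteq> par_closure K"
  proof -
    obtain w where w: "w \<in> carrier W" and "dominant (\<lambda>v. f (act w v))" "finite (stab f)"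
      and pos: "\<forall>s\<in>S. f (act w (simple_root s)) = 0 \<longrightarrow> act w (simple_root s) \<in> Pos"
      and gen: "stab f \<subseteq> generate W ((\<lambda>s. w \<otimes> s \<otimes> inv w) ` {s \<in> S. f (act w (simple_root s)) = 0})"
      by (rule stab_parabolic[OF f fin])
    have "w \<otimes> s \<otimes> inv w \<in> par_closure K" if s: "s \<in> S" "f (act w (simple_root s)) = 0" for s
    proof -
      let ?\<gamma> = "act w (simple_root s)"
      have g: "?\<gamma> \<in> Pos" "?\<gamma> \<in> R" "?\<gamma> \<in> V" using pos s PosD root_in_V by blast+
      then have "?\<gamma> \<in> N" using small s by auto
      then have z: "avg K ?\<gamma> = (\<lambda>t. 0)" using r(2)[of "avg K ?\<gamma>"] s by (auto simp: X_def f_def)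
      have "avg K (act (refl_of W S ?\<gamma>) v) = avg K v" if "v \<in> V" for v
        by (simp only: act_refl_of[OF g(2) that] avg_comb[OF sub that g(3)] z) simp
      then have "refl_of W S ?\<gamma> \<in> par_closure K"
        using g by (simp add: stab_def refl_of_closed)
      then show ?thesis using w s by (simp add: refl_of_act)
    qed
    then show ?thesis
      by (intro order_trans[OF gen] generate_subgroup_incl subgroup_stab) blast
  qed
  ultimately show ?thesis using that f fin by blast
qed


lemma finite_par_closure:
  assumes "subgroup K W" "finite K"
  shows "finite (par_closure K)"
proof -
  obtain f where f: "functional f" "finite {\<gamma> \<in> Pos. f \<gamma> \<le> 0}" "par_closure K = stab f"
    using assms by (rule par_closure_eq_stab)
  then show ?thesis using stab_parabolic[OF f(1,2)] by auto
qed

section \<open>Maximal locally finite subgroups\<close>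

lemma locally_finite_directed_union:
  assumes dir: "\<And>F. finite F \<Longrightarrow> F \<subseteq> U \<Longrightarrow> \<exists>P. subgroup P W \<and> finite P \<and> F \<subseteq> P \<and> P \<subseteq> U"
  shows "locally_finite_subgroup W U"
proof -
  have ex: "\<exists>P. subgroup P W \<and> x \<in> P \<and> y \<in> P \<and> P \<subseteq> U" if "x \<in> U" "y \<in> U" for x y
    using dir[of "{x, y}"] that by auto
  have "subgroup U W"
  proof (rule subgroupI)
    show "U \<subseteq> carrier W" using ex subgroup.mem_carrier by fastforce
    show "U \<noteq> {}" using dir[of "{}"] subgroup.one_closed by blast
    show "inv x \<in> U" if "x \<in> U" for x using ex that subgroup.m_inv_closed by (metis subsetD)
    show "x \<otimes> y \<in> U" if "x \<in> U" "y \<in> U" for x y using ex that subgroup.m_closed by (metis subsetD)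
  qed
  moreover have "finite (generate W F)" if F: "finite F" "F \<subseteq> U" for F
  proof -
    obtain P where "subgroup P W" "finite P" "F \<subseteq> P" using dir[OF F] by blast
    then show ?thesis using generate_subgroup_incl[of F P] finite_subset by blast
  qed
  ultimately show ?thesis by (simp add: locally_finite_subgroup_def)
qed

lemma finite_generate:
  assumes "locally_finite_subgroup W M" "finite F" "F \<subseteq> M"
  shows "subgroup (generate W F) W" "finite (generate W F)" "generate W F \<subseteq> M" "F \<subseteq> generate W F"
proof -
  have M: "subgroup M W" using assms by (simp add: locally_finite_subgroup_def)
  then have "F \<subseteq> carrier W" using assms subgroup.subset by blast
  then show "subgroup (generate W F) W" by (rule generate_is_subgroup)
  show "finite (generate W F)" using assms by (simp add: locally_finite_subgroup_def)
  show "generate W F \<subseteq> M" using assms M by (intro generate_subgroup_incl)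
  show "F \<subseteq> generate W F" by (auto intro: generate.incl)
qed

lemma maximal_contains_closures:
  assumes max: "maximal_locally_finite_subgroup W M"
    and K: "subgroup K W" "finite K" "K \<subseteq> M"
  shows "par_closure K \<subseteq> M"
proof -
  have M: "locally_finite_subgroup W M" using max by (simp add: maximal_locally_finite_subgroup_def)
  define \<K> where "\<K> = {K. subgroup K W \<and> finite K \<and> K \<subseteq> M}"
  define U where "U = (\<Union>K\<in>\<K>. par_closure K)"
  have gen: "generate W F \<in> \<K>" "F \<subseteq> generate W F" if "finite F" "F \<subseteq> M" for F
    using finite_generate[OF M that] by (auto simp: \<K>_def)
  \<comment> \<open>Directedness: two finite subgroups of \<open>M\<close> generate a finite one
    since \<open>M\<close> is locally finite, and its closure contains both closures by
    monotonicity.\<close>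
  have cover: "\<exists>K\<in>\<K>. F \<subseteq> par_closure K" if "finite F" "F \<subseteq> U" for F
    using that
  proof (induction F rule: finite_induct)
    case empty
    then show ?case using gen[of "{}"] by blast
  next
    case (insert x F)
    then obtain K1 K2 where K12: "K1 \<in> \<K>" "F \<subseteq> par_closure K1" "K2 \<in> \<K>" "x \<in> par_closure K2"
      by (auto simp: U_def)
    let ?K = "generate W (K1 \<union> K2)"
    have K: "?K \<in> \<K>" "K1 \<union> K2 \<subseteq> ?K" using gen[of "K1 \<union> K2"] K12 by (auto simp: \<K>_def)
    then have "par_closure K1 \<subseteq> par_closure ?K" "par_closure K2 \<subseteq> par_closure ?K"
      using K12 by (auto simp: \<K>_def intro!: par_closure_mono del: subsetI)
    then show ?case using K K12 by blast
  qed
  have "locally_finite_subgroup W U"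
  proof (intro locally_finite_directed_union)
    fix F assume "finite F" "F \<subseteq> U"
    with cover obtain K where "K \<in> \<K>" "F \<subseteq> par_closure K" by blast
    then show "\<exists>P. subgroup P W \<and> finite P \<and> F \<subseteq> P \<and> P \<subseteq> U"
      by (intro exI[of _ "par_closure K"]) (auto simp: \<K>_def U_def subgroup_stab finite_par_closure)
  qed
  moreover have "M \<subseteq> U"
  proof
    fix x assume "x \<in> M"
    then have *: "generate W {x} \<in> \<K>" "x \<in> generate W {x}" using gen[of "{x}"] by auto
    then have "x \<in> par_closure (generate W {x})"
      using par_closure_superset[of "generate W {x}"] by (auto simp: \<K>_def)
    then show "x \<in> U" using * by (auto simp: U_def)
  qed
  ultimately have "U = M" using max by (auto simp: maximal_locally_finite_subgroup_def)
  then show ?thesis using K by (auto simp: U_def \<K>_def)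
qed

text \<open>The usable form of indecomposability, with the set and the coefficients as explicit
  parameters; finiteness of \<open>F\<close> is the one condition left to contradict.\<close>

lemma canon_root_indecomposable:
  assumes "\<gamma> \<in> canon_roots W S M" "(\<lambda>t. \<Sum>\<beta>\<in>F. c \<beta> * \<beta> t) = \<gamma>"
    "F \<subseteq> {\<beta> \<in> Pos. refl_of W S \<beta> \<in> M \<and> \<beta> \<noteq> \<gamma>}" "\<forall>\<beta>\<in>F. 0 < c \<beta>"
  shows "infinite F"
proof
  assume "finite F"
  with assms(2-4) have "\<exists>F c. finite F \<and> F \<subseteq> {\<beta> \<in> Pos. refl_of W S \<beta> \<in> M \<and> \<beta> \<noteq> \<gamma>}
      \<and> (\<forall>\<beta>\<in>F. 0 < c \<beta>) \<and> \<gamma> = (\<lambda>t. \<Sum>\<beta>\<in>F. c \<beta> * \<beta> t)"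
    by (intro exI[of _ F] exI[of _ c]) simp
  with assms(1) show False
    unfolding canon_roots_def mem_Collect_eq by (elim conjE notE)
qed

lemma maximal_locally_parabolic:
  assumes max: "maximal_locally_finite_subgroup W M"
  shows "locally_parabolic W S M"
proof -
  have M: "locally_finite_subgroup W M" using max by (simp add: maximal_locally_finite_subgroup_def)
  then have sM: "subgroup M W" by (simp add: locally_finite_subgroup_def)
  \<comment> \<open>Needed twice: for single elements, to see that reflections generate
    \<open>M\<close>, and for finite sets of canonical generators, which must all be conjugated into
    \<open>S\<close> by one and the same \<open>w\<close>.\<close>
  have local: "\<exists>w f. functional f \<and> w \<in> carrier W \<and> dominant (\<lambda>v. f (act w v))
      \<and> F \<subseteq> stab f \<and> stab f \<subseteq> M
      \<and> (\<forall>s\<in>S. f (act w (simple_root s)) = 0 \<longrightarrow> act w (simple_root s) \<in> Pos)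
      \<and> stab f \<subseteq> generate W ((\<lambda>s. w \<otimes> s \<otimes> inv w) ` {s \<in> S. f (act w (simple_root s)) = 0})"
    if F: "finite F" "F \<subseteq> M" for F
  proof -
    note K = finite_generate[OF M F]
    obtain f where f: "functional f" "finite {\<gamma> \<in> Pos. f \<gamma> \<le> 0}" "par_closure (generate W F) = stab f"
      using par_closure_eq_stab[OF K(1,2)] by blast
    have "F \<subseteq> stab f" using par_closure_superset[OF K(1)] K(4) f by auto
    moreover have "stab f \<subseteq> M" using maximal_contains_closures[OF max K(1-3)] f by simp
    moreover obtain w where "w \<in> carrier W" "dominant (\<lambda>v. f (act w v))" and "finite (stab f)"
      and "\<forall>s\<in>S. f (act w (simple_root s)) = 0 \<longrightarrow> act w (simple_root s) \<in> Pos"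
        "stab f \<subseteq> generate W ((\<lambda>s. w \<otimes> s \<otimes> inv w) ` {s \<in> S. f (act w (simple_root s)) = 0})"
      by (rule stab_parabolic[OF f(1,2)])
    ultimately show ?thesis using f(1) by (intro exI[of _ w] exI[of _ f]) auto
  qed
  have refl_M: "w \<otimes> s \<otimes> inv w \<in> stab f"
    if "functional f" "w \<in> carrier W" "s \<in> S" "f (act w (simple_root s)) = 0" for f w s
    using refl_of_in_stab[of f "act w (simple_root s)"] that
    by (simp add: refl_of_act act_simple_root_in_R)
  have "M \<subseteq> generate W (reflections W S \<inter> M)"
  proof
    fix x assume "x \<in> M"
    then have "finite {x}" "{x} \<subseteq> M" by auto
    from local[OF this] obtain w f where wf: "functional f" "w \<in> carrier W" "x \<in> stab f" "stab f \<subseteq> M"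
      "stab f \<subseteq> generate W ((\<lambda>s. w \<otimes> s \<otimes> inv w) ` {s \<in> S. f (act w (simple_root s)) = 0})"
      by (elim exE conjE) (simp only: insert_subset)
    have "(\<lambda>s. w \<otimes> s \<otimes> inv w) ` {s \<in> S. f (act w (simple_root s)) = 0} \<subseteq> reflections W S \<inter> M"
      using wf refl_M[OF wf(1,2)] by (auto simp: reflections_def)
    then show "x \<in> generate W (reflections W S \<inter> M)"
      using wf mono_generate by blast
  qed
  moreover have "generate W (reflections W S \<inter> M) \<subseteq> M"
    using sM by (intro generate_subgroup_incl) auto
  ultimately have "reflection_subgroup W S M"
    by (auto simp: reflection_subgroup_def)
  moreover have "\<exists>w\<in>carrier W. (\<lambda>x. w \<otimes> x \<otimes> inv w) ` F \<subseteq> S"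
    if F: "finite F" "F \<subseteq> canon_gens W S M" for F
  proof -
    have "F \<subseteq> M" using F(2) by (auto simp: canon_gens_def canon_roots_def)
    then obtain w f where wf: "functional f" "w \<in> carrier W" "dominant (\<lambda>v. f (act w v))"
      "F \<subseteq> stab f" "stab f \<subseteq> M"
      "\<And>s. s \<in> S \<Longrightarrow> f (act w (simple_root s)) = 0 \<Longrightarrow> act w (simple_root s) \<in> Pos"
      using local[OF F(1)] by blast
    have "inv w \<otimes> x \<otimes> w \<in> S" if x: "x \<in> F" for x
    proof -
      obtain \<gamma> where g: "\<gamma> \<in> canon_roots W S M" "x = refl_of W S \<gamma>"
        using F x by (auto simp: canon_gens_def)
      then have gP: "\<gamma> \<in> Pos" "\<gamma> \<in> R" "\<gamma> \<in> V" by (auto simp: canon_roots_def PosD root_in_V)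
      \<comment> \<open>The reflection \<open>x\<close> fixes \<open>f\<close> and negates \<gamma>,
        so the value at \<gamma> equals its own negative.\<close>
      have "f (act x \<gamma>) = f \<gamma>" using wf(4) x gP by (auto simp: stab_def)
      then have f0: "f \<gamma> = 0" using g gP wf(1) by (simp add: refl_of_self functional_uminus)
      define \<beta>0 where "\<beta>0 = act (inv w) \<gamma>"
      \<comment> \<open>Pulling back by \<open>w\<close> may give a negative root, so the sign is
        first adjusted to make the simple coordinates nonnegative. That no adjustment occurred
        follows once \<open>act w \<beta>\<close> is seen to be positive, as \<gamma> is.\<close>
      define \<beta> where "\<beta> = (if \<beta>0 \<in> Pos then \<beta>0 else (\<lambda>t. - \<beta>0 t))"
      have b0: "\<beta>0 \<in> R" "act w \<beta>0 = \<gamma>" using wf(2) gP by (simp_all add: \<beta>0_def act_R)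
      have b: "\<beta> \<in> Pos" using b0 not_Pos_uminus by (simp add: \<beta>_def)
      then have bV: "\<beta> \<in> V" using PosD root_in_V by blast
      have wb: "act w \<beta> = \<gamma> \<or> act w \<beta> = (\<lambda>t. - \<gamma> t)"
        using b0 wf(2) by (simp add: \<beta>_def act_uminus root_in_V)
      then have "f (act w \<beta>) = 0" using f0 functional_uminus[OF wf(1) gP(3)] by auto
      then have simple: "f (act w (simple_root s)) = 0" if "s \<in> supp \<beta>" for s
        using dominant_Pos_zero[OF wf(3) b] that by blast
      have suppS: "finite (supp \<beta>)" "supp \<beta> \<subseteq> S" using bV by (auto simp: V_def)
      have pos: "act w (simple_root s) \<in> Pos" if "s \<in> supp \<beta>" for s
        using wf(6) simple that suppS by blast
      have bpos: "0 < \<beta> s" if "s \<in> supp \<beta>" for s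
        using PosD(2)[OF b, of s] that by (auto simp: supp_def)
      have "act w (\<lambda>t. \<Sum>s\<in>supp \<beta>. \<beta> s * simple_root s t)
          = (\<lambda>t. \<Sum>s\<in>supp \<beta>. \<beta> s * act w (simple_root s) t)"
        using suppS wf(2) by (intro act_sum) (auto simp: V_simple_root)
      then have exp: "act w \<beta> = (\<lambda>t. \<Sum>s\<in>supp \<beta>. \<beta> s * act w (simple_root s) t)"
        using V_expand[OF bV] by simp
      have "0 \<le> act w \<beta> t" for t
        unfolding exp using bpos pos PosD(2) by (intro sum_nonneg mult_nonneg_nonneg) (auto intro: less_imp_le)
      moreover have "act w \<beta> \<in> R" using act_R wf(2) PosD b by blast
      ultimately have "act w \<beta> \<in> Pos" by (simp add: pos_roots_def)
      then have w\<beta>: "act w \<beta> = \<gamma>" using wb not_pos_and_neg gP(1) by auto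
      have "\<exists>s\<in>supp \<beta>. act w (simple_root s) = \<gamma>"
      proof (rule ccontr)
        assume none: "\<not> ?thesis"
        \<comment> \<open>Indecomposability speaks of combinations indexed by roots, while the
          expansion is indexed by simple reflections. Injectivity of \<open>r\<close> lets the
          coefficients be transported; the reflections of these roots lie in \<open>stab f\<close>,
          hence in \<open>M\<close>.\<close>
        define r where "r s = act w (simple_root s)" for s
        have inj: "inj_on r (supp \<beta>)"
        proof (rule inj_onI)
          fix s t assume st: "s \<in> supp \<beta>" "t \<in> supp \<beta>" "r s = r t"
          then have "simple_root s = simple_root t"
            using act_inj[OF wf(2)] suppS V_simple_root by (auto simp: r_def subset_iff)
          then have "supp (simple_root s) = supp (simple_root t)" by (rule arg_cong)
          then show "s = t" by simp
        qed
        define c where "c \<delta> = \<beta> (inv_into (supp \<beta>) r \<delta>)" for \<delta>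
        have c: "c (r s) = \<beta> s" if "s \<in> supp \<beta>" for s
          using inj that by (simp add: c_def)
        have "(\<lambda>t. \<Sum>\<delta>\<in>r ` supp \<beta>. c \<delta> * \<delta> t) = \<gamma>"
          unfolding w\<beta> [symmetric] exp sum.reindex[OF inj] o_def
          by (intro ext sum.cong refl) (simp only: c, simp only: r_def)
        moreover have "r ` supp \<beta> \<subseteq> {\<delta> \<in> Pos. refl_of W S \<delta> \<in> M \<and> \<delta> \<noteq> \<gamma>}"
          using pos none refl_M[OF wf(1,2)] simple suppS wf(2,5)
          by (auto simp: r_def refl_of_act subset_iff)
        moreover have "\<forall>\<delta>\<in>r ` supp \<beta>. 0 < c \<delta>" using c bpos by auto
        moreover have "finite (r ` supp \<beta>)" using suppS by simp
        ultimately show False using canon_root_indecomposable[OF g(1), where F = "r ` supp \<beta>" and c = c] by simp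
      qed
      then obtain s where s: "s \<in> S" "\<gamma> = act w (simple_root s)" using suppS by blast
      then have "x = w \<otimes> s \<otimes> inv w" using g wf(2) by (simp add: refl_of_act)
      then have "inv w \<otimes> x \<otimes> w = s"
        using wf(2) s by (simp add: m_assoc S_carrier) (simp add: m_assoc [symmetric] S_carrier)
      then show ?thesis using s by simp
    qed
    then show ?thesis using wf(2) by (intro bexI[of _ "inv w"]) auto
  qed
  ultimately show ?thesis by (auto simp: locally_parabolic_def)
qed

end

section \<open>Existence of maximal locally finite subgroups\<close>

lemma locally_finite_Union_chain:
  assumes "C \<noteq> {}" "subset.chain {K. locally_finite_subgroup W K} C" "group W"
  shows "locally_finite_subgroup W (\<Union>C)"
proof -
  interpret group W by fact
  have C: "locally_finite_subgroup W K" "subgroup K W" if "K \<in> C" for K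
    using assms(2) that by (auto simp: subset.chain_def locally_finite_subgroup_def)
  have single: "\<exists>K\<in>C. F \<subseteq> K" if "finite F" "F \<subseteq> \<Union>C" for F
    using finite_subset_Union_chain[OF that assms(1)] assms(2) by metis
  have "subgroup (\<Union>C) W"
  proof (rule subgroupI)
    show "\<Union>C \<subseteq> carrier W" using C subgroup.subset by blast
    show "\<Union>C \<noteq> {}" using assms(1) C subgroup.one_closed by blast
    show "inv\<^bsub>W\<^esub> x \<in> \<Union>C" if "x \<in> \<Union>C" for x
      using that C subgroup.m_inv_closed by (metis Union_iff)
    show "x \<otimes>\<^bsub>W\<^esub> y \<in> \<Union>C" if xy: "x \<in> \<Union>C" "y \<in> \<Union>C" for x y
    proof -
      obtain K where K: "K \<in> C" "x \<in> K" "y \<in> K" using single[of "{x, y}"] xy by auto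
      then have "x \<otimes>\<^bsub>W\<^esub> y \<in> K" using subgroup.m_closed[OF C(2)] by blast
      then show ?thesis using K by blast
    qed
  qed
  moreover have "finite (generate W F)" if "finite F" "F \<subseteq> \<Union>C" for F
    using single[OF that] C that by (auto simp: locally_finite_subgroup_def)
  ultimately show ?thesis by (simp add: locally_finite_subgroup_def)
qed

lemma maximal_locally_finite_exists:
  assumes "group W" "locally_finite_subgroup W H"
  shows "\<exists>M. maximal_locally_finite_subgroup W M \<and> H \<subseteq> M"
proof -
  have "\<exists>M\<in>{K. locally_finite_subgroup W K \<and> H \<subseteq> K}. \<forall>X\<in>{K. locally_finite_subgroup W K \<and> H \<subseteq> K}. M \<subseteq> X \<longrightarrow> X = M"
  proof (rule subset_Zorn_nonempty)
    show "{K. locally_finite_subgroup W K \<and> H \<subseteq> K} \<noteq> {}" using assms by auto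
    fix C assume C: "C \<noteq> {}" "subset.chain {K. locally_finite_subgroup W K \<and> H \<subseteq> K} C"
    then have "subset.chain {K. locally_finite_subgroup W K} C"
      by (auto simp: subset.chain_def)
    moreover have "H \<subseteq> \<Union>C" using C by (fastforce simp: subset.chain_def)
    ultimately show "\<Union>C \<in> {K. locally_finite_subgroup W K \<and> H \<subseteq> K}"
      using locally_finite_Union_chain[OF C(1)] assms(1) by blast
  qed
  then show ?thesis by (auto simp: maximal_locally_finite_subgroup_def) (metis subset_trans)
qed

theorem theorem5p6:
  fixes W :: "('a, 'b) monoid_scheme" and S :: "'a set"
  assumes "coxeter_system W S"
    and "\<exists>r. well_order_on S r"
  shows "\<forall>H. locally_finite_subgroup W H \<longrightarrow>
           (\<exists>M. maximal_locally_finite_subgroup W M \<and> H \<subseteq> M) \<and>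
           (\<forall>M. maximal_locally_finite_subgroup W M \<and> H \<subseteq> M \<longrightarrow> locally_parabolic W S M)"
proof -
  have "group W" using assms by (simp add: coxeter_system_def)
  then interpret coxeter W S
    using assms by (simp add: coxeter_def coxeter_axioms_def)
  show ?thesis
    using maximal_locally_finite_exists[OF \<open>group W\<close>] maximal_locally_parabolic by blast
qed

end
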